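(* Let $n\ge1$, $p\in[1,\infty]$ and $\phi_1,\dots,\phi_n\in\mathcal{B}$ be such that $$\Big(\int_{(0,\infty)^n}\Big(\frac{\min\{1,t_1,\dots,t_n\}}{\phi_1(t_1)\cdots\phi_n(t_n)}\Big)^p\frac{dt_1}{t_1}\cdots\frac{dt_n}{t_n}\Big)^{1/p}<\infty$$ (with the supremum in place of the integral if $p=\infty$). Then $K_p^{\phi_1,\dots,\phi_n}$ is an exact interpolation functor of type $f$, where $$f(t_0,\dots,t_n)=t_0\,\overline{\phi_1}(t_1/t_0)\cdots\overline{\phi_n}(t_n/t_0),$$ that is: (i) for every $\mathbf{A}\in\mathscr{B}_n$, $K_p^{\phi_1,\dots,\phi_n}(\mathbf{A})$ is a Banach space and $\Delta(\mathbf{A})\hookrightarrow K_p^{\phi_1,\dots,\phi_n}(\mathbf{A})\hookrightarrow\Sigma(\mathbf{A})$ continuously; (ii) every morphism $T:\mathbf{A}\to\mathbf{B}$ in $\mathscr{B}_n$ restricts to a bounded linear operator $K_p^{\phi_1,\dots,\phi_n}(\mathbf{A})\to K_p^{\phi_1,\dots,\phi_n}(\mathbf{B})$, and, whenever the norms $\|T\|_{A_j,B_j}$ are all positive, $$\|T\|_{K_p^{\phi_1,\dots,\phi_n}(\mathbf{A}),K_p^{\phi_1,\dots,\phi_n}(\mathbf{B})}\le f\big(\|T\|_{A_0,B_0},\dots,\|T\|_{A_n,B_n}\big).$$ Moreover, for every $\mathbf{A}\in\mathscr{B}_n$ there is a constant $C>0$ such that for all $a\in K_p^{\phi_1,\dots,\phi_n}(\mathbf{A})$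 and all $t_1,\dots,t_n>0$, $$K(1,t_1,\dots,t_n,a)\le C\,\phi_1(t_1)\cdots\phi_n(t_n)\,\|a\|_{K_p^{\phi_1,\dots,\phi_n}(\mathbf{A})}.$$
   Context: $\mathcal{B}$ is the set of Boyd functions: continuous functions $\phi:(0,\infty)\to(0,\infty)$ with $\phi(1)=1$ and $\overline{\phi}(t)=\sup_{s>0}\phi(ts)/\phi(s)<\infty$ for every $t>0$. $\mathscr{B}_n$ is the collection of $(n+1)$-tuples $\mathbf{A}=(A_0,\dots,A_n)$ of Banach spaces such that each $A_j$ is linearly and continuously embedded in a common Hausdorff topological vector space $\mathcal{A}$. A morphism $T:\mathbf{A}\to\mathbf{B}$ is a linear map between the ambient spaces $\mathcal{A}$ and $\mathcal{B}_{\mathrm{amb}}$ of $\mathbf{A}$ and $\mathbf{B}$ which restricts to a bounded linear operator $A_j\to B_j$ for each $j$, with norm $\|T\|_{A_j,B_j}$. $\Sigma(\mathbf{A})=A_0+\dots+A_n$ has norm $\inf\{\sum_j\|a_j\|_{A_j}: a=\sum_j a_j,\ a_j\in A_j\}$; $\Delta(\mathbf{A})=A_0\cap\dots\cap A_n$ has norm $\max_j\|a\|_{A_j}$. $\hookrightarrow$ denotes continuous inclusion. For $a\in\Sigma(\mathbf{A})$ and $t\in(0,\infty)^{n+1}$, $K(t,a)=\inf\{t_0\|a_0\|_{A_0}+\dots+t_n\|a_n\|_{A_n}\}$ over all decompositions $a=a_0+\dots+a_n$, $a_j\in A_j$. $K_p^{\phi_1,\dots,\phi_n}(\mathbf{A})$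 is the set of $a\in\Sigma(\mathbf{A})$ with $$\|a\|_{K_p^{\phi_1,\dots,\phi_n}(\mathbf{A})}=\Big(\int_{(0,\infty)^n}\Big(\frac{K(1,t_1,\dots,t_n,a)}{\phi_1(t_1)\cdots\phi_n(t_n)}\Big)^p\frac{dt_1}{t_1}\cdots\frac{dt_n}{t_n}\Big)^{1/p}<\infty$$ (supremum if $p=\infty$). *)

theory Defs
  imports "HOL-Analysis.Analysis"
begin

section \<open>Boyd functions\<close>

definition boyd_function :: "(real \<Rightarrow> real) \<Rightarrow> bool" where
  "boyd_function \<phi> \<longleftrightarrow>
     continuous_on {0<..} \<phi> \<and> (\<forall>t>0. \<phi> t > 0) \<and> \<phi> 1 = 1 \<and>
     (\<forall>t>0. bdd_above ((\<lambda>s. \<phi> (t * s) / \<phi> s) ` {0<..}))"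

definition boyd_bar :: "(real \<Rightarrow> real) \<Rightarrow> real \<Rightarrow> real" where
  "boyd_bar \<phi> t = (SUP s\<in>{0<..}. \<phi> (t * s) / \<phi> s)"

section \<open>Normed spaces inside a Hausdorff topological vector space\<close>

text \<open>
  The scalar field \<open>'k\<close> is a field with multiplicative norm extending the real numbers, so that
  real and complex spaces are both covered. Ambient spaces are types carrying a Hausdorff group
  topology, together with an explicit scalar multiplication.
\<close>

definition topological_vector_space ::
    "('k::real_normed_field \<Rightarrow> 'a::{topological_ab_group_add, t2_space} \<Rightarrow> 'a) \<Rightarrow> bool" where
  "topological_vector_space s \<longleftrightarrow>
     vector_space s \<and> continuous_on UNIV (\<lambda>(c, x). s c x)"

text \<open>Values of \<open>nnorm X\<close> outside \<open>points X\<close> carry no meaning.\<close>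

record 'a nspace =
  points :: "'a set"
  nnorm :: "'a \<Rightarrow> real"

definition normed_space_on ::
    "('k::real_normed_field \<Rightarrow> 'a::ab_group_add \<Rightarrow> 'a) \<Rightarrow> 'a nspace \<Rightarrow> bool" where
  "normed_space_on s X \<longleftrightarrow>
     module.subspace s (points X) \<and>
     (\<forall>x\<in>points X. nnorm X x \<ge> 0 \<and> (nnorm X x = 0 \<longleftrightarrow> x = 0)) \<and>
     (\<forall>c. \<forall>x\<in>points X. nnorm X (s c x) = norm c * nnorm X x) \<and>
     (\<forall>x\<in>points X. \<forall>y\<in>points X. nnorm X (x + y) \<le> nnorm X x + nnorm X y)"

text \<open>
  \<open>Metric_space\<close> requires distances to be nonnegative and symmetric on the whole type, hence the
  value 0 outside of \<open>points X\<close>, which has no influence on the metric topology of \<open>points X\<close>.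
\<close>

definition ndist :: "'a::ab_group_add nspace \<Rightarrow> 'a \<Rightarrow> 'a \<Rightarrow> real" where
  "ndist X x y = (if x \<in> points X \<and> y \<in> points X then nnorm X (x - y) else 0)"

definition ntopology :: "'a::ab_group_add nspace \<Rightarrow> 'a topology" where
  "ntopology X = Metric_space.mtopology (points X) (ndist X)"

definition banach_space_on ::
    "('k::real_normed_field \<Rightarrow> 'a::ab_group_add \<Rightarrow> 'a) \<Rightarrow> 'a nspace \<Rightarrow> bool" where
  "banach_space_on s X \<longleftrightarrow>
     normed_space_on s X \<and> Metric_space.mcomplete (points X) (ndist X)"

lemma Metric_space_ndist:
  assumes s: "vector_space s" and X: "normed_space_on s X"
  shows "Metric_space (points X) (ndist X)"
proof -
  interpret vector_space s by (fact s)
  have sub: "subspace (points X)"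
    using X by (simp add: normed_space_on_def)
  have diff: "x - y \<in> points X" if "x \<in> points X" "y \<in> points X" for x y
    using sub that by (rule subspace_diff)
  have minus: "nnorm X (x - y) = nnorm X (y - x)" if "x \<in> points X" "y \<in> points X" for x y
  proof -
    have "x - y = s (- 1) (y - x)"
      by simp
    then have "nnorm X (x - y) = norm (- 1 :: 'a) * nnorm X (y - x)"
      using X diff[OF that(2,1)] unfolding normed_space_on_def by metis
    then show ?thesis
      by simp
  qed
  have tri: "nnorm X (x - z) \<le> nnorm X (x - y) + nnorm X (y - z)"
    if "x \<in> points X" "y \<in> points X" "z \<in> points X" for x y z
  proof -
    have "nnorm X ((x - y) + (y - z)) \<le> nnorm X (x - y) + nnorm X (y - z)"
      using X diff[OF that(1,2)] diff[OF that(2,3)] unfolding normed_space_on_def by blast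
    then show ?thesis
      by simp
  qed
  show ?thesis
  proof
    show "0 \<le> ndist X x y" for x y
      using X diff by (auto simp: ndist_def normed_space_on_def)
    show "ndist X x y = ndist X y x" for x y
      using minus by (auto simp: ndist_def)
    show "ndist X x y = 0 \<longleftrightarrow> x = y" if "x \<in> points X" "y \<in> points X" for x y
      using X diff that by (auto simp: ndist_def normed_space_on_def)
    show "ndist X x z \<le> ndist X x y + ndist X y z"
      if "x \<in> points X" "y \<in> points X" "z \<in> points X" for x y z
      using tri that by (simp add: ndist_def)
  qed
qed

definition continuous_inclusion ::
    "'a::ab_group_add nspace \<Rightarrow> 'a nspace \<Rightarrow> bool" where
  "continuous_inclusion X Y \<longleftrightarrow>
     points X \<subseteq> points Y \<and> continuous_map (ntopology X) (ntopology Y) (\<lambda>x. x)"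

section \<open>Tuples of Banach spaces and their morphisms\<close>

text \<open>
  A tuple \<open>(A 0, \<dots>, A n)\<close> is given by a function on the natural numbers whose values beyond \<open>n\<close> are
  irrelevant. Each member is identified with its image under the embedding into the ambient space.
\<close>

definition banach_tuple ::
    "nat \<Rightarrow> ('k::real_normed_field \<Rightarrow> 'a::{topological_ab_group_add, t2_space} \<Rightarrow> 'a) \<Rightarrow>
      (nat \<Rightarrow> 'a nspace) \<Rightarrow> bool" where
  "banach_tuple n s A \<longleftrightarrow>
     topological_vector_space s \<and>
     (\<forall>j\<le>n. banach_space_on s (A j) \<and> continuous_map (ntopology (A j)) euclidean (\<lambda>x. x))"

definition bounded_between :: "'a nspace \<Rightarrow> 'b nspace \<Rightarrow> ('a \<Rightarrow> 'b) \<Rightarrow> bool" where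
  "bounded_between X Y T \<longleftrightarrow>
     T ` points X \<subseteq> points Y \<and> (\<exists>C. \<forall>x\<in>points X. nnorm Y (T x) \<le> C * nnorm X x)"

definition opnorm :: "'a nspace \<Rightarrow> 'b nspace \<Rightarrow> ('a \<Rightarrow> 'b) \<Rightarrow> real" where
  "opnorm X Y T = (SUP x\<in>{x \<in> points X. nnorm X x \<le> 1}. nnorm Y (T x))"

definition tuple_morphism ::
    "nat \<Rightarrow> ('k::real_normed_field \<Rightarrow> 'a::ab_group_add \<Rightarrow> 'a) \<Rightarrow> (nat \<Rightarrow> 'a nspace) \<Rightarrow>
      ('k \<Rightarrow> 'b::ab_group_add \<Rightarrow> 'b) \<Rightarrow> (nat \<Rightarrow> 'b nspace) \<Rightarrow> ('a \<Rightarrow> 'b) \<Rightarrow> bool" where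
  "tuple_morphism n sA A sB B T \<longleftrightarrow>
     Vector_Spaces.linear sA sB T \<and> (\<forall>j\<le>n. bounded_between (A j) (B j) T)"

definition decompositions ::
    "nat \<Rightarrow> (nat \<Rightarrow> 'a::ab_group_add nspace) \<Rightarrow> 'a \<Rightarrow> (nat \<Rightarrow> 'a) set" where
  "decompositions n A a = {x. (\<forall>j\<le>n. x j \<in> points (A j)) \<and> a = (\<Sum>j\<le>n. x j)}"

definition sum_space :: "nat \<Rightarrow> (nat \<Rightarrow> 'a::ab_group_add nspace) \<Rightarrow> 'a nspace" where
  "sum_space n A =
     \<lparr>points = {a. decompositions n A a \<noteq> {}},
      nnorm = (\<lambda>a. INF x\<in>decompositions n A a. \<Sum>j\<le>n. nnorm (A j) (x j))\<rparr>"

definition intersection_space :: "nat \<Rightarrow> (nat \<Rightarrow> 'a nspace) \<Rightarrow> 'a nspace" where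
  "intersection_space n A =
     \<lparr>points = (\<Inter>j\<in>{..n}. points (A j)),
      nnorm = (\<lambda>a. Max ((\<lambda>j. nnorm (A j) a) ` {..n}))\<rparr>"

section \<open>The K-functional and the K-method\<close>

definition K_functional ::
    "nat \<Rightarrow> (nat \<Rightarrow> 'a::ab_group_add nspace) \<Rightarrow> (nat \<Rightarrow> real) \<Rightarrow> 'a \<Rightarrow> real" where
  "K_functional n A t a = (INF x\<in>decompositions n A a. \<Sum>j\<le>n. t j * nnorm (A j) (x j))"

text \<open>Points \<open>(t\<^sub>1, \<dots>, t\<^sub>n)\<close> of \<open>(0,\<infinity>)\<^sup>n\<close> are extensional functions on \<open>{1..n}\<close>.\<close>

definition pos_orthant :: "nat \<Rightarrow> (nat \<Rightarrow> real) set" where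
  "pos_orthant n = PiE {1..n} (\<lambda>_. {0<..})"

definition ennreal_powr :: "ennreal \<Rightarrow> real \<Rightarrow> ennreal" where
  "ennreal_powr x r = (if x = \<infinity> then \<infinity> else ennreal (enn2real x powr r))"

text \<open>
  The norm of a nonnegative function \<open>F\<close> in \<open>L\<^sup>p\<close> of the measure \<open>dt\<^sub>1/t\<^sub>1 \<dots> dt\<^sub>n/t\<^sub>n\<close> on
  \<open>(0,\<infinity>)\<^sup>n\<close>; for infinite \<open>p\<close> it is the supremum over all points, not an essential supremum.
\<close>

definition Lp_star :: "nat \<Rightarrow> ennreal \<Rightarrow> ((nat \<Rightarrow> real) \<Rightarrow> real) \<Rightarrow> ennreal" where
  "Lp_star n p F =
     (if p = \<infinity> then (SUP t\<in>pos_orthant n. ennreal (F t))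
      else ennreal_powr
        (\<integral>\<^sup>+t\<in>pos_orthant n. ennreal (F t powr enn2real p * (\<Prod>j=1..n. 1 / t j))
           \<partial>PiM {1..n} (\<lambda>_. lborel))
        (1 / enn2real p))"

definition K_enorm ::
    "nat \<Rightarrow> ennreal \<Rightarrow> (nat \<Rightarrow> real \<Rightarrow> real) \<Rightarrow> (nat \<Rightarrow> 'a::ab_group_add nspace) \<Rightarrow> 'a \<Rightarrow> ennreal"
  where
  "K_enorm n p \<phi> A a =
     Lp_star n p (\<lambda>t. K_functional n A (t(0 := 1)) a / (\<Prod>j=1..n. \<phi> j (t j)))"

definition K_space ::
    "nat \<Rightarrow> ennreal \<Rightarrow> (nat \<Rightarrow> real \<Rightarrow> real) \<Rightarrow> (nat \<Rightarrow> 'a::ab_group_add nspace) \<Rightarrow> 'a nspace"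
  where
  "K_space n p \<phi> A =
     \<lparr>points = {a \<in> points (sum_space n A). K_enorm n p \<phi> A a < \<infinity>},
      nnorm = (\<lambda>a. enn2real (K_enorm n p \<phi> A a))\<rparr>"

definition type_function :: "nat \<Rightarrow> (nat \<Rightarrow> real \<Rightarrow> real) \<Rightarrow> (nat \<Rightarrow> real) \<Rightarrow> real" where
  "type_function n \<phi> t = t 0 * (\<Prod>j=1..n. boyd_bar (\<phi> j) (t j / t 0))"

end

theory Submission
  imports Defs
begin

text \<open>
  The measure \<open>dt\<^sub>1/t\<^sub>1 \<dots> dt\<^sub>n/t\<^sub>n\<close> is invariant under \<open>t \<mapsto> c t\<close> for every positive vector \<open>c\<close>.
  As \<open>K(1, t u, a) \<ge> min(1, u) K(1, t, a)\<close> and \<open>\<phi>\<^sub>j(t u) \<le> boyd_bar \<phi>\<^sub>j(u) \<phi>\<^sub>j(t)\<close>, translating the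
  integral defining the norm by \<open>t\<close> bounds it from below by a constant times
  \<open>K(1, t, a) / (\<phi>\<^sub>1(t\<^sub>1) \<dots> \<phi>\<^sub>n(t\<^sub>n))\<close>; at \<open>t = 1\<close> this is the embedding into the sum space. Completeness
  follows from that of the sum space by Fatou's lemma, and \<open>K(1, t, a) \<le> min(1, t) \<parallel>a\<parallel>\<close> embeds the
  intersection. For a morphism with norms \<open>M\<^sub>j\<close> one has \<open>K(1, t, T a) \<le> M\<^sub>0 K(1, c t, a)\<close> where
  \<open>c\<^sub>j = M\<^sub>j / M\<^sub>0\<close>, and translating by \<open>c\<close> costs the factor \<open>boyd_bar \<phi>\<^sub>1(c\<^sub>1) \<dots> boyd_bar \<phi>\<^sub>n(c\<^sub>n)\<close>.
\<close>

section \<open>The Haar measure of the positive orthant\<close>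

text \<open>The integrability hypothesis acts twice. It supplies the constant of the embedding of
  the intersection, and, since \<open>\<phi> 1 = 1\<close> gives
  \<open>\<phi> \<le> boyd_bar \<phi>\<close>, it makes the constant of the lower bound finite: that
  constant is the norm of \<open>min(1, u)\<close> divided by the product of the
  \<open>boyd_bar (\<phi> j) (u j)\<close>. Two measurability questions shape the proof: K is an
  infimum over uncountably many decompositions, and \<open>boyd_bar \<phi>\<close> is a supremum
  that may fail to be continuous. Both are answered on the orthant only, because Boyd functions are
  controlled only at positive arguments. For this reason the measure below lives on the restricted
  space instead of carrying an indicator: its space is the orthant, so pointwise facts are asked for
  only there. Definiteness of the norms is the point at which the Hausdorff ambient topology enters.
  Finally, the exact bound presupposes positive operator norms whereas boundedness does not, so the
  estimate for morphisms is proved for arbitrary positive bounds \<open>M j\<close>.\<close>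

definition orthant_measure :: "nat \<Rightarrow> (nat \<Rightarrow> real) measure" where
  "orthant_measure n =
     density (restrict_space (PiM {1..n} (\<lambda>_. lborel)) (pos_orthant n)) (\<lambda>t. ennreal (\<Prod>j=1..n. 1 / t j))"

lemma pos_orthant_sets [measurable]: "pos_orthant n \<in> sets (PiM {1..n} (\<lambda>_. lborel))"
  unfolding pos_orthant_def by (rule sets_PiM_I_finite) auto

lemma space_orthant_measure [simp]: "space (orthant_measure n) = pos_orthant n"
  by (auto simp: orthant_measure_def space_restrict_space space_PiM pos_orthant_def)

lemma measurable_orthant_measure:
  "measurable (orthant_measure n) N = measurable (restrict_space (PiM {1..n} (\<lambda>_. lborel)) (pos_orthant n)) N"
  by (rule measurable_cong_sets) (simp_all add: orthant_measure_def)

lemma measurable_orthant_component: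
  "j \<in> {1..n} \<Longrightarrow> (\<lambda>t. t j) \<in> borel_measurable (orthant_measure n)"
  unfolding measurable_orthant_measure
  by (intro measurable_restrict_space1) (use measurable_component_singleton[of j "{1..n}" "\<lambda>_. lborel"] in simp)

lemma measurable_orthant_density [measurable]:
  "(\<lambda>t. ennreal (\<Prod>j=1..n. 1 / t j)) \<in> borel_measurable (orthant_measure n)"
proof -
  have "(\<lambda>t. \<Prod>j=1..n. 1 / t j) \<in> borel_measurable (orthant_measure n)"
    by (rule borel_measurable_prod, rule borel_measurable_divide)
       (simp_all only: borel_measurable_const measurable_orthant_component)
  then show ?thesis
    by (rule measurable_compose[OF _ measurable_ennreal])
qed

lemma nn_integral_orthant_measure:
  assumes F: "F \<in> borel_measurable (orthant_measure n)"
  shows "(\<integral>\<^sup>+t. F t \<partial>orthant_measure n) =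
    (\<integral>\<^sup>+t. ennreal (\<Prod>j=1..n. 1 / t j) * F t * indicator (pos_orthant n) t \<partial>PiM {1..n} (\<lambda>_. lborel))"
  using measurable_orthant_density[of n] F sets.Int[OF pos_orthant_sets[of n] sets.top]
  unfolding measurable_orthant_measure
  by (simp add: orthant_measure_def nn_integral_density nn_integral_restrict_space)

lemma measurable_scale_PiM [measurable]:
  "(\<lambda>t. \<lambda>j\<in>I. c j * t j) \<in> measurable (PiM I (\<lambda>_. lborel)) (PiM I (\<lambda>_. lborel :: real measure))"
proof (rule measurable_restrict)
  fix j assume "j \<in> I"
  then have "(\<lambda>t. t j) \<in> borel_measurable (PiM I (\<lambda>_. lborel :: real measure))"
    using measurable_component_singleton[of j I "\<lambda>_. lborel :: real measure"] by simp
  then show "(\<lambda>t. c j * t j) \<in> measurable (PiM I (\<lambda>_. lborel)) (lborel :: real measure)"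
    by simp
qed

text \<open>Uniqueness of the product measure reduces this change of variables to boxes, where it
  factors into the scaling law of Lebesgue measure on the line. \<open>?D\<close> is the image
  measure multiplied by the Jacobian.\<close>

lemma nn_integral_PiM_scale:
  fixes c :: "'i \<Rightarrow> real"
  assumes I: "finite I" and c: "\<And>j. j \<in> I \<Longrightarrow> c j > 0"
    and h: "h \<in> borel_measurable (PiM I (\<lambda>_. lborel))"
  shows "(\<integral>\<^sup>+t. h t \<partial>PiM I (\<lambda>_. lborel)) =
    ennreal (\<Prod>j\<in>I. c j) * (\<integral>\<^sup>+t. h (\<lambda>j\<in>I. c j * t j) \<partial>PiM I (\<lambda>_. lborel))"
proof -
  interpret product_sigma_finite "\<lambda>_. lborel :: real measure"
    by (simp add: product_sigma_finite_def lborel.sigma_finite_measure_axioms)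
  let ?L = "PiM I (\<lambda>_. lborel :: real measure)"
  let ?S = "\<lambda>t. \<lambda>j\<in>I. c j * t j"
  let ?D = "density (distr ?L ?L ?S) (\<lambda>_. ennreal (\<Prod>j\<in>I. c j))"
  have 1: "ennreal (c j) * emeasure lborel ((\<lambda>x. c j * x) -` B) = emeasure lborel B"
    if "j \<in> I" "B \<in> sets borel" for j B
  proof -
    have "emeasure lborel ((\<lambda>x. c j * x) -` B) = emeasure (distr lborel borel ((*) (c j))) B"
      using that by (simp add: emeasure_distr)
    also have "\<dots> = emeasure (density lborel (\<lambda>_. inverse \<bar>c j\<bar>)) B"
      using c[OF that(1)] by (subst lborel_distr_mult) auto
    also have "\<dots> = ennreal (inverse (c j)) * emeasure lborel B"
      using that c[OF that(1)] by (simp add: emeasure_density_const)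
    finally show ?thesis
      using c[OF that(1)] by (simp add: mult.assoc[symmetric] ennreal_mult[symmetric])
  qed
  have "?D = ?L"
  proof (rule PiM_eqI)
    fix B :: "'i \<Rightarrow> real set" assume B: "\<And>j. j \<in> I \<Longrightarrow> B j \<in> sets lborel"
    have m: "Pi\<^sub>E I B \<in> sets ?L"
      using B I by (intro sets_PiM_I_finite) auto
    have "emeasure ?D (Pi\<^sub>E I B) = ennreal (\<Prod>j\<in>I. c j) * emeasure ?L (?S -` Pi\<^sub>E I B \<inter> space ?L)"
      using m by (simp add: emeasure_density_const emeasure_distr)
    also have "?S -` Pi\<^sub>E I B \<inter> space ?L = (\<Pi>\<^sub>E j\<in>I. (\<lambda>x. c j * x) -` B j)"
      by (auto simp: space_PiM PiE_iff extensional_def)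
    also have "emeasure ?L \<dots> = (\<Prod>j\<in>I. emeasure lborel ((\<lambda>x. c j * x) -` B j))"
    proof (intro emeasure_PiM I)
      fix j assume "j \<in> I"
      then have "B j \<in> sets borel"
        using B by simp
      then have "(\<lambda>x. c j * x) -` B j \<in> sets borel"
        by (rule measurable_sets_borel[rotated]) simp
      then show "(\<lambda>x. c j * x) -` B j \<in> sets lborel"
        by simp
    qed
    also have "ennreal (\<Prod>j\<in>I. c j) * \<dots> = (\<Prod>j\<in>I. ennreal (c j) * emeasure lborel ((\<lambda>x. c j * x) -` B j))"
      using c by (subst prod_ennreal[symmetric]) (auto simp: prod.distrib less_imp_le)
    also have "\<dots> = (\<Prod>j\<in>I. emeasure lborel (B j))"
      using 1 B by (intro prod.cong) auto
    finally show "emeasure ?D (Pi\<^sub>E I B) = (\<Prod>j\<in>I. emeasure lborel (B j))" .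
  qed (use I in auto)
  then have "(\<integral>\<^sup>+t. h t \<partial>?L) = (\<integral>\<^sup>+t. h t \<partial>?D)"
    by simp
  also have "\<dots> = ennreal (\<Prod>j\<in>I. c j) * (\<integral>\<^sup>+t. h (?S t) \<partial>?L)"
    using h by (simp add: nn_integral_density nn_integral_distr nn_integral_cmult)
  finally show ?thesis .
qed

text \<open>The rescaled function is restricted to \<open>{1..n}\<close> and therefore always
  extensional; the implication from left to right thus has to be told that \<open>t\<close>
  is.\<close>

lemma scale_pos_orthant_iff:
  assumes "\<And>j. j \<in> {1..n} \<Longrightarrow> c j > 0" "t \<in> extensional {1..n}"
  shows "(\<lambda>j\<in>{1..n}. c j * t j) \<in> pos_orthant n \<longleftrightarrow> t \<in> pos_orthant n"
proof -
  have "0 < c j * t j \<longleftrightarrow> 0 < t j" if "j \<in> {1..n}" for j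
    using assms(1)[OF that] by (simp add: zero_less_mult_iff)
  then show ?thesis
    using assms(2) by (simp add: pos_orthant_def PiE_iff)
qed

lemma measurable_scale_orthant:
  assumes c: "\<And>j. j \<in> {1..n} \<Longrightarrow> c j > 0"
  shows "(\<lambda>t. \<lambda>j\<in>{1..n}. c j * t j) \<in> measurable (orthant_measure n) (orthant_measure n)"
proof -
  have "(\<lambda>t. \<lambda>j\<in>{1..n}. c j * t j) \<in> measurable (orthant_measure n) (restrict_space (PiM {1..n} (\<lambda>_. lborel)) (pos_orthant n))"
    unfolding measurable_orthant_measure
    by (intro measurable_restrict_space3 measurable_scale_PiM)
       (use c in \<open>auto simp: pos_orthant_def PiE_iff\<close>)
  also have "\<dots> = measurable (orthant_measure n) (orthant_measure n)"
    by (rule measurable_cong_sets) (simp_all add: orthant_measure_def)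
  finally show ?thesis .
qed

text \<open>The Jacobian, the product of the \<open>c j\<close>, cancels against the density, which
  at the rescaled point is the product of the \<open>1 / (c j * t j)\<close>.\<close>

lemma nn_integral_orthant_measure_scale:
  assumes c: "\<And>j. j \<in> {1..n} \<Longrightarrow> c j > 0" and F: "F \<in> borel_measurable (orthant_measure n)"
  shows "(\<integral>\<^sup>+t. F (\<lambda>j\<in>{1..n}. c j * t j) \<partial>orthant_measure n) = (\<integral>\<^sup>+t. F t \<partial>orthant_measure n)"
proof -
  let ?L = "PiM {1..n} (\<lambda>_. lborel :: real measure)"
  let ?S = "\<lambda>t. \<lambda>j\<in>{1..n}. c j * t j"
  define h where "h = (\<lambda>t. ennreal (\<Prod>j=1..n. 1 / t j) * F t * indicator (pos_orthant n) t)"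
  have S: "?S \<in> measurable (orthant_measure n) (orthant_measure n)"
    using c by (rule measurable_scale_orthant)
  have m: "(\<lambda>t. ennreal (\<Prod>j=1..n. 1 / t j) * F t) \<in> borel_measurable (orthant_measure n)"
    using F by measurable
  have "h \<in> borel_measurable ?L"
    using m sets.Int[OF pos_orthant_sets[of n] sets.top] unfolding measurable_orthant_measure h_def
    by (subst (asm) borel_measurable_restrict_space_iff_ennreal) auto
  then have "(\<integral>\<^sup>+t. h t \<partial>?L) = ennreal (\<Prod>j=1..n. c j) * (\<integral>\<^sup>+t. h (?S t) \<partial>?L)"
    using c by (intro nn_integral_PiM_scale) auto
  also have "\<dots> = (\<integral>\<^sup>+t. ennreal (\<Prod>j=1..n. c j) * h (?S t) \<partial>?L)"
    using measurable_compose[OF measurable_scale_PiM \<open>h \<in> borel_measurable ?L\<close>]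
    by (intro nn_integral_cmult[symmetric])
  also have "\<dots> = (\<integral>\<^sup>+t. ennreal (\<Prod>j=1..n. 1 / t j) * F (?S t) * indicator (pos_orthant n) t \<partial>?L)"
  proof (rule nn_integral_cong)
    fix t assume "t \<in> space ?L"
    then have e: "t \<in> extensional {1..n}"
      by (simp add: space_PiM PiE_def)
    show "ennreal (\<Prod>j=1..n. c j) * h (?S t) =
      ennreal (\<Prod>j=1..n. 1 / t j) * F (?S t) * indicator (pos_orthant n) t"
    proof (cases "t \<in> pos_orthant n")
      case True
      have "(\<Prod>j=1..n. c j) * (\<Prod>j=1..n. 1 / ?S t j) = (\<Prod>j=1..n. 1 / t j)"
        unfolding prod.distrib[symmetric]
      proof (rule prod.cong[OF refl])
        fix j assume "j \<in> {1..n}"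
        then show "c j * (1 / ?S t j) = 1 / t j"
          using c[of j] by simp
      qed
      moreover have "(\<Prod>j=1..n. 1 / ?S t j) \<ge> 0" "(\<Prod>j=1..n. c j) \<ge> 0"
        using c True by (auto intro!: prod_nonneg simp: pos_orthant_def PiE_iff less_imp_le)
      ultimately have "ennreal (\<Prod>j=1..n. c j) * ennreal (\<Prod>j=1..n. 1 / ?S t j) = ennreal (\<Prod>j=1..n. 1 / t j)"
        by (subst ennreal_mult[symmetric]) auto
      then show ?thesis
        using True scale_pos_orthant_iff[where c=c, OF c e] by (simp add: h_def mult.assoc[symmetric])
    next
      case False
      then show ?thesis
        using scale_pos_orthant_iff[where c=c, OF c e] by (simp add: h_def)
    qed
  qed
  also have "\<dots> = (\<integral>\<^sup>+t. F (?S t) \<partial>orthant_measure n)"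
    by (rule nn_integral_orthant_measure[OF measurable_compose[OF S F], symmetric])
  finally show ?thesis
    using nn_integral_orthant_measure[OF F] by (simp add: h_def)
qed

text \<open>A vanishing integral would make a positive integrand zero almost everywhere and so the
  orthant a null set, but its Lebesgue measure is a product of nonzero factors.\<close>

lemma nn_integral_orthant_measure_pos:
  assumes F: "F \<in> borel_measurable (orthant_measure n)" and pos: "\<And>t. t \<in> pos_orthant n \<Longrightarrow> F t > 0"
  shows "(\<integral>\<^sup>+t. F t \<partial>orthant_measure n) > 0"
proof (rule ccontr)
  interpret product_sigma_finite "\<lambda>_. lborel :: real measure"
    by (simp add: product_sigma_finite_def lborel.sigma_finite_measure_axioms)
  let ?L = "PiM {1..n} (\<lambda>_. lborel :: real measure)"
  define h where "h = (\<lambda>t. ennreal (\<Prod>j=1..n. 1 / t j) * F t * indicator (pos_orthant n) t)"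
  have m: "(\<lambda>t. ennreal (\<Prod>j=1..n. 1 / t j) * F t) \<in> borel_measurable (orthant_measure n)"
    using F by measurable
  have h: "h \<in> borel_measurable ?L"
    using m sets.Int[OF pos_orthant_sets[of n] sets.top] unfolding measurable_orthant_measure h_def
    by (subst (asm) borel_measurable_restrict_space_iff_ennreal) auto
  assume "\<not> ?thesis"
  then have "(\<integral>\<^sup>+t. h t \<partial>?L) = 0"
    using nn_integral_orthant_measure[OF F] by (simp add: h_def)
  then have ae: "AE t in ?L. h t = 0"
    by (rule nn_integral_0_iff_AE[OF h, THEN iffD1])
  have h0: "h t \<noteq> 0" if "t \<in> pos_orthant n" for t
  proof -
    have "(\<Prod>j=1..n. 1 / t j) > 0"
      using that by (auto intro!: prod_pos simp: pos_orthant_def PiE_iff)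
    then have "ennreal (\<Prod>j=1..n. 1 / t j) \<noteq> 0"
      by (simp only: ennreal_eq_0_iff not_le)
    then show ?thesis
      using that pos[OF that] by (simp only: h_def indicator_simps mult_1_right mult_eq_0_iff) simp
  qed
  from ae have "AE t in ?L. t \<notin> pos_orthant n"
    by (rule eventually_mono) (use h0 in blast)
  then have "emeasure ?L (pos_orthant n) = 0"
    using AE_iff_null_sets[OF pos_orthant_sets[of n]] by (auto dest: null_setsD1)
  moreover have "emeasure ?L (pos_orthant n) = (\<Prod>j\<in>{1..n}. emeasure lborel {0::real<..})"
    unfolding pos_orthant_def by (intro emeasure_PiM) auto
  moreover have "emeasure lborel {0::real<..} \<noteq> 0"
  proof -
    have "emeasure lborel {0<..1::real} \<le> emeasure lborel {0::real<..}"
      by (rule emeasure_mono) auto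
    then show ?thesis by auto
  qed
  ultimately show False
    using power_not_zero by (metis prod_constant)
qed

section \<open>The norm of \<open>L\<^sup>p\<close> over the orthant\<close>

text \<open>Moves the root to the other side, so that a finite bound on a norm becomes a bound on an
  integral.\<close>

lemma ennreal_powr_le_iff:
  assumes "q > 0" "C \<ge> 0"
  shows "ennreal_powr x (1 / q) \<le> ennreal C \<longleftrightarrow> x \<le> ennreal (C powr q)"
proof (cases x)
  case (real r)
  have "r powr (1 / q) \<le> C \<longleftrightarrow> r \<le> C powr q"
  proof
    assume "r powr (1 / q) \<le> C"
    then have "(r powr (1 / q)) powr q \<le> C powr q"
      using assms by (intro powr_mono2) auto
    then show "r \<le> C powr q"
      using real assms by (simp add: powr_powr)
  next
    assume "r \<le> C powr q"
    then have "r powr (1 / q) \<le> (C powr q) powr (1 / q)"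
      using assms real by (intro powr_mono2) auto
    then show "r powr (1 / q) \<le> C"
      using assms by (simp add: powr_powr)
  qed
  then show ?thesis
    using real assms by (simp add: ennreal_powr_def)
next
  case top
  then show ?thesis
    by (simp add: ennreal_powr_def top_unique)
qed

lemma ennreal_powr_mono: "x \<le> y \<Longrightarrow> r \<ge> 0 \<Longrightarrow> ennreal_powr x r \<le> ennreal_powr y r"
  by (auto simp: ennreal_powr_def top_unique less_top intro!: ennreal_leI powr_mono2 enn2real_mono)

lemma Lp_star_finite:
  assumes F: "F \<in> borel_measurable (orthant_measure n)" and p: "p \<noteq> \<infinity>"
  shows "Lp_star n p F =
    ennreal_powr (\<integral>\<^sup>+t. ennreal (F t powr enn2real p) \<partial>orthant_measure n) (1 / enn2real p)"
proof -
  have "(\<integral>\<^sup>+t\<in>pos_orthant n. ennreal (F t powr enn2real p * (\<Prod>j=1..n. 1 / t j)) \<partial>PiM {1..n} (\<lambda>_. lborel)) =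
    (\<integral>\<^sup>+t. ennreal (\<Prod>j=1..n. 1 / t j) * ennreal (F t powr enn2real p) * indicator (pos_orthant n) t
      \<partial>PiM {1..n} (\<lambda>_. lborel))"
  proof (intro nn_integral_cong)
    fix t
    show "ennreal (F t powr enn2real p * (\<Prod>j=1..n. 1 / t j)) * indicator (pos_orthant n) t =
      ennreal (\<Prod>j=1..n. 1 / t j) * ennreal (F t powr enn2real p) * indicator (pos_orthant n) t"
      by (simp add: ennreal_mult' mult.commute)
  qed
  also have "\<dots> = (\<integral>\<^sup>+t. ennreal (F t powr enn2real p) \<partial>orthant_measure n)"
    using F by (intro nn_integral_orthant_measure[symmetric]) measurable
  finally show ?thesis
    using p by (simp add: Lp_star_def)
qed

lemma Lp_star_le_iff:
  assumes "F \<in> borel_measurable (orthant_measure n)" "p \<ge> 1" "p \<noteq> \<infinity>" "C \<ge> 0"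
  shows "Lp_star n p F \<le> ennreal C \<longleftrightarrow>
    (\<integral>\<^sup>+t. ennreal (F t powr enn2real p) \<partial>orthant_measure n) \<le> ennreal (C powr enn2real p)"
proof -
  have "enn2real p > 0"
    using assms(2,3) by (simp add: enn2real_positive_iff less_top order.strict_trans2[of 0 1])
  then show ?thesis
    using assms by (simp add: Lp_star_finite ennreal_powr_le_iff)
qed

lemma Lp_star_infinity_le_iff:
  "p = \<infinity> \<Longrightarrow> Lp_star n p F \<le> x \<longleftrightarrow> (\<forall>t\<in>pos_orthant n. ennreal (F t) \<le> x)"
  by (simp add: Lp_star_def SUP_le_iff)

lemma enn2real_ge_1: "p \<ge> 1 \<Longrightarrow> p \<noteq> \<infinity> \<Longrightarrow> enn2real p \<ge> 1"
  by (cases p) auto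

lemma Lp_star_mono:
  assumes F: "F \<in> borel_measurable (orthant_measure n)" and G: "G \<in> borel_measurable (orthant_measure n)"
    and p: "p \<ge> 1"
    and le: "\<And>t. t \<in> pos_orthant n \<Longrightarrow> 0 \<le> F t" "\<And>t. t \<in> pos_orthant n \<Longrightarrow> F t \<le> G t"
  shows "Lp_star n p F \<le> Lp_star n p G"
proof (cases "p = \<infinity>")
  case True
  then show ?thesis
    using le unfolding Lp_star_def by (auto intro!: SUP_mono ennreal_leI)
next
  case False
  have "(\<integral>\<^sup>+t. ennreal (F t powr enn2real p) \<partial>orthant_measure n)
      \<le> (\<integral>\<^sup>+t. ennreal (G t powr enn2real p) \<partial>orthant_measure n)"
    using le enn2real_ge_1[OF p False] by (intro nn_integral_mono ennreal_leI powr_mono2) auto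
  then show ?thesis
    unfolding Lp_star_finite[OF F False] Lp_star_finite[OF G False]
    by (intro ennreal_powr_mono) simp_all
qed

lemma Lp_star_cmult_le:
  assumes F: "F \<in> borel_measurable (orthant_measure n)" and p: "p \<ge> 1" and c: "c \<ge> 0"
    and nn: "\<And>t. t \<in> pos_orthant n \<Longrightarrow> 0 \<le> F t" and C: "C \<ge> 0" "Lp_star n p F \<le> ennreal C"
  shows "Lp_star n p (\<lambda>t. c * F t) \<le> ennreal (c * C)"
proof (cases "p = \<infinity>")
  case True
  then show ?thesis
    using C c unfolding Lp_star_infinity_le_iff[OF True]
    by (auto intro!: mult_left_mono)
next
  case False
  let ?q = "enn2real p"
  have "(\<integral>\<^sup>+t. ennreal ((c * F t) powr ?q) \<partial>orthant_measure n) =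
      (\<integral>\<^sup>+t. ennreal (c powr ?q) * ennreal (F t powr ?q) \<partial>orthant_measure n)"
    using c nn by (intro nn_integral_cong) (auto simp: powr_mult ennreal_mult)
  also have "\<dots> = ennreal (c powr ?q) * (\<integral>\<^sup>+t. ennreal (F t powr ?q) \<partial>orthant_measure n)"
    using F by (intro nn_integral_cmult) measurable
  also have "\<dots> \<le> ennreal (c powr ?q) * ennreal (C powr ?q)"
    using C F p False by (intro mult_left_mono) (auto simp: Lp_star_le_iff)
  also have "\<dots> = ennreal ((c * C) powr ?q)"
    using c C by (simp add: powr_mult ennreal_mult)
  finally show ?thesis
    using F p False c C by (subst Lp_star_le_iff) auto
qed

text \<open>The reverse inequality is the forward one for the factor \<open>1 / c\<close>, applied
  to \<open>c * F t\<close>.\<close>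

lemma Lp_star_cmult:
  assumes F: "F \<in> borel_measurable (orthant_measure n)" and p: "p \<ge> 1" and c: "c \<ge> 0"
    and nn: "\<And>t. t \<in> pos_orthant n \<Longrightarrow> 0 \<le> F t" and fin: "Lp_star n p F < \<infinity>"
  shows "Lp_star n p (\<lambda>t. c * F t) = ennreal c * Lp_star n p F"
proof -
  obtain C where C: "C \<ge> 0" "Lp_star n p F = ennreal C"
    using fin by (cases "Lp_star n p F") auto
  have le: "Lp_star n p (\<lambda>t. c * F t) \<le> ennreal (c * C)"
    using F p c nn C by (intro Lp_star_cmult_le) auto
  show ?thesis
  proof (cases "c = 0")
    case True
    then show ?thesis using le by simp
  next
    case False
    obtain D where D: "D \<ge> 0" "Lp_star n p (\<lambda>t. c * F t) = ennreal D"
      using le by (cases "Lp_star n p (\<lambda>t. c * F t)") (auto simp: top_unique)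
    have "Lp_star n p (\<lambda>t. (1 / c) * (c * F t)) \<le> ennreal ((1 / c) * D)"
      using F p c nn D by (intro Lp_star_cmult_le) auto
    then have "ennreal C \<le> ennreal (D / c)"
      using False C by simp
    then have "c * C \<le> D"
      using False c D by (simp add: field_simps)
    then show ?thesis
      using le C D c by (simp add: ennreal_mult[symmetric])
  qed
qed

text \<open>Convexity of the power is invoked at positive arguments only. If \<open>x\<close> or
  \<open>y\<close> is zero, the claim reduces to \<open>v powr q \<le> v\<close> for
  \<open>v\<close> between 0 and 1.\<close>

lemma powr_convex_combination:
  fixes x y :: real
  assumes "q \<ge> 1" "0 \<le> u" "u \<le> 1" "x \<ge> 0" "y \<ge> 0"
  shows "((1 - u) * x + u * y) powr q \<le> (1 - u) * x powr q + u * y powr q"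
proof -
  have small: "(v * z) powr q \<le> v * z powr q" if "0 \<le> v" "v \<le> 1" "z \<ge> 0" for v z :: real
  proof -
    have "v powr q \<le> v powr 1"
      using that assms(1) by (intro powr_mono') auto
    then show ?thesis
      using that by (simp add: powr_mult mult_right_mono)
  qed
  show ?thesis
  proof (cases "x = 0 \<or> y = 0")
    case True
    then show ?thesis
      using small[of u y] small[of "1 - u" x] assms by auto
  next
    case False
    then show ?thesis
      using convex_onD[OF powr_convex[OF assms(1)], of u x y] assms by simp
  qed
qed

text \<open>
  \<open>(F + G) / (C + D)\<close> is a convex combination of \<open>F / C\<close> and \<open>G / D\<close>, so Minkowski's inequality
  follows from the convexity of the power function.
\<close>

lemma Lp_star_triangle_le:
  assumes F: "F \<in> borel_measurable (orthant_measure n)" and G: "G \<in> borel_measurable (orthant_measure n)"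
    and p: "p \<ge> 1"
    and nn: "\<And>t. t \<in> pos_orthant n \<Longrightarrow> 0 \<le> F t" "\<And>t. t \<in> pos_orthant n \<Longrightarrow> 0 \<le> G t"
    and C: "C > 0" "Lp_star n p F \<le> ennreal C" and D: "D > 0" "Lp_star n p G \<le> ennreal D"
  shows "Lp_star n p (\<lambda>t. F t + G t) \<le> ennreal (C + D)"
proof (cases "p = \<infinity>")
  case True
  then show ?thesis
    using C D unfolding Lp_star_infinity_le_iff[OF True]
    by (auto intro!: ennreal_leI add_mono simp del: ennreal_plus)
next
  case False
  let ?q = "enn2real p"
  let ?H = "orthant_measure n"
  have q: "?q \<ge> 1"
    by (rule enn2real_ge_1[OF p False])
  define u where "u = D / (C + D)"
  have u: "0 \<le> u" "u \<le> 1" "1 - u = C / (C + D)" "1 - u \<ge> 0"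
    using C D by (auto simp: u_def field_simps)
  define E where "E = (C + D) powr ?q"
  have pw: "(F t + G t) powr ?q
      \<le> E * (1 - u) / C powr ?q * F t powr ?q + E * u / D powr ?q * G t powr ?q"
    if t: "t \<in> pos_orthant n" for t
  proof -
    have "F t + G t = (C + D) * ((1 - u) * (F t / C) + u * (G t / D))"
    proof -
      have "(C + D) * ((C / (C + D)) * (F t / C) + (D / (C + D)) * (G t / D)) = F t + G t"
        using C D by (simp add: distrib_left)
      then show ?thesis
        unfolding u(3) by (simp add: u_def)
    qed
    then have "(F t + G t) powr ?q = E * ((1 - u) * (F t / C) + u * (G t / D)) powr ?q"
      using C D u nn[OF t] by (simp add: E_def powr_mult)
    also have "\<dots> \<le> E * ((1 - u) * (F t / C) powr ?q + u * (G t / D) powr ?q)"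
      using C D u(1,2) nn[OF t] q by (intro mult_left_mono powr_convex_combination) (auto simp: E_def simp del: diff_ge_0_iff_ge)
    also have "\<dots> = E * (1 - u) / C powr ?q * F t powr ?q + E * u / D powr ?q * G t powr ?q"
      using C D nn[OF t] by (simp only: powr_divide less_imp_le distrib_left) (simp add: ac_simps)
    finally show ?thesis .
  qed
  have "(\<integral>\<^sup>+t. ennreal ((F t + G t) powr ?q) \<partial>?H) \<le>
      (\<integral>\<^sup>+t. ennreal (E * (1 - u) / C powr ?q) * ennreal (F t powr ?q) +
        ennreal (E * u / D powr ?q) * ennreal (G t powr ?q) \<partial>?H)"
  proof (intro nn_integral_mono)
    fix t assume "t \<in> space ?H"
    then have "ennreal ((F t + G t) powr ?q)
      \<le> ennreal (E * (1 - u) / C powr ?q * F t powr ?q + E * u / D powr ?q * G t powr ?q)"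
      using pw by (intro ennreal_leI) auto
    also have "\<dots> = ennreal (E * (1 - u) / C powr ?q) * ennreal (F t powr ?q) +
        ennreal (E * u / D powr ?q) * ennreal (G t powr ?q)"
    proof -
      have "E \<ge> 0"
        by (simp add: E_def)
      then have "E * (1 - u) / C powr ?q \<ge> 0" "E * u / D powr ?q \<ge> 0"
        using u(1,4) by (auto simp del: diff_ge_0_iff_ge)
      then show ?thesis
        by (subst ennreal_plus) (simp_all add: ennreal_mult' del: times_divide_eq_left times_divide_eq_right)
    qed
    finally show "ennreal ((F t + G t) powr ?q) \<le> \<dots>" .
  qed
  also have "\<dots> = ennreal (E * (1 - u) / C powr ?q) * (\<integral>\<^sup>+t. ennreal (F t powr ?q) \<partial>?H) +
      ennreal (E * u / D powr ?q) * (\<integral>\<^sup>+t. ennreal (G t powr ?q) \<partial>?H)"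
    using F G by (simp add: nn_integral_add nn_integral_cmult)
  also have "\<dots> \<le> ennreal (E * (1 - u) / C powr ?q) * ennreal (C powr ?q) +
      ennreal (E * u / D powr ?q) * ennreal (D powr ?q)"
    using C D F G p False by (intro add_mono mult_left_mono) (auto simp: Lp_star_le_iff)
  also have "\<dots> = ennreal (E * (1 - u) + E * u)"
    using C D u by (simp add: ennreal_mult[symmetric] ennreal_plus[symmetric] E_def del: ennreal_plus)
  also have "E * (1 - u) + E * u = (C + D) powr ?q"
    by (simp add: E_def algebra_simps)
  finally show ?thesis
    using F G p False C D by (subst Lp_star_le_iff) auto
qed

lemma Lp_star_triangle:
  assumes F: "F \<in> borel_measurable (orthant_measure n)" and G: "G \<in> borel_measurable (orthant_measure n)"
    and p: "p \<ge> 1"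
    and nn: "\<And>t. t \<in> pos_orthant n \<Longrightarrow> 0 \<le> F t" "\<And>t. t \<in> pos_orthant n \<Longrightarrow> 0 \<le> G t"
  shows "Lp_star n p (\<lambda>t. F t + G t) \<le> Lp_star n p F + Lp_star n p G"
proof (cases "Lp_star n p F + Lp_star n p G = \<infinity>")
  case False
  then obtain C D where CD: "C \<ge> 0" "D \<ge> 0" "Lp_star n p F = ennreal C" "Lp_star n p G = ennreal D"
    by (cases "Lp_star n p F"; cases "Lp_star n p G") auto
  \<comment> \<open>\<open>Lp_star_triangle_le\<close> divides by its two bounds. As either norm may
    be zero, both are enlarged by \<open>e / 2\<close> and \<open>e\<close> is arbitrary.\<close>
  have "Lp_star n p (\<lambda>t. F t + G t) \<le> ennreal (C + D) + ennreal e" if "e > 0" for e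
  proof -
    have "Lp_star n p (\<lambda>t. F t + G t) \<le> ennreal ((C + e / 2) + (D + e / 2))"
      using assms CD that by (intro Lp_star_triangle_le) (auto intro!: ennreal_leI)
    also have "\<dots> = ennreal (C + D) + ennreal e"
      using CD that by (simp add: ennreal_plus[symmetric] del: ennreal_plus)
    finally show ?thesis .
  qed
  then have "Lp_star n p (\<lambda>t. F t + G t) \<le> ennreal (C + D)"
    by (rule ennreal_le_epsilon)
  then show ?thesis
    using CD by simp
next
  case True
  then show ?thesis
    by (simp only: infinity_ennreal_def top_greatest)
qed

text \<open>For infinite \<open>p\<close> a bound on the supremum is a bound at every point, which
  survives the pointwise limit; for finite \<open>p\<close> Fatou's lemma is applied to the powers.
  No dominating function is required.\<close>

lemma Lp_star_Fatou:
  assumes F: "\<And>k. F k \<in> borel_measurable (orthant_measure n)" and p: "p \<ge> 1"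
    and nn: "\<And>k t. t \<in> pos_orthant n \<Longrightarrow> 0 \<le> F k t"
    and lim: "\<And>t. t \<in> pos_orthant n \<Longrightarrow> (\<lambda>k. F k t) \<longlonglongrightarrow> G t"
    and C: "C \<ge> 0" "eventually (\<lambda>k. Lp_star n p (F k) \<le> ennreal C) sequentially"
  shows "Lp_star n p G \<le> ennreal C"
proof (cases "p = \<infinity>")
  case True
  have "ennreal (G t) \<le> ennreal C" if t: "t \<in> pos_orthant n" for t
  proof (rule tendsto_upperbound)
    show "(\<lambda>k. ennreal (F k t)) \<longlonglongrightarrow> ennreal (G t)"
      using lim[OF t] by (rule tendsto_ennrealI)
    show "eventually (\<lambda>k. ennreal (F k t) \<le> ennreal C) sequentially"
      using C(2) by eventually_elim (use t in \<open>simp add: Lp_star_infinity_le_iff[OF True]\<close>)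
  qed simp
  then show ?thesis
    by (simp add: Lp_star_infinity_le_iff[OF True])
next
  case False
  let ?q = "enn2real p"
  let ?H = "orthant_measure n"
  have q: "?q \<ge> 1"
    by (rule enn2real_ge_1[OF p False])
  have G: "G \<in> borel_measurable ?H"
    by (rule borel_measurable_LIMSEQ_metric[where f=F]) (use F lim in auto)
  have Gnn: "G t \<ge> 0" if "t \<in> pos_orthant n" for t
    using lim[OF that] nn[OF that] by (intro LIMSEQ_le_const) auto
  have "(\<integral>\<^sup>+t. ennreal (G t powr ?q) \<partial>?H) = (\<integral>\<^sup>+t. liminf (\<lambda>k. ennreal (F k t powr ?q)) \<partial>?H)"
  proof (intro nn_integral_cong)
    fix t assume "t \<in> space ?H"
    then have t: "t \<in> pos_orthant n" by simp
    have "(\<lambda>k. ennreal (F k t powr ?q)) \<longlonglongrightarrow> ennreal (G t powr ?q)"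
      using lim[OF t] nn[OF t] q by (intro tendsto_ennrealI tendsto_powr') auto
    then show "ennreal (G t powr ?q) = liminf (\<lambda>k. ennreal (F k t powr ?q))"
      by (intro lim_imp_Liminf[symmetric]) auto
  qed
  also have "\<dots> \<le> liminf (\<lambda>k. \<integral>\<^sup>+t. ennreal (F k t powr ?q) \<partial>?H)"
    using F by (intro nn_integral_liminf) measurable
  also have "\<dots> \<le> ennreal (C powr ?q)"
  proof -
    have "eventually (\<lambda>k. (\<integral>\<^sup>+t. ennreal (F k t powr ?q) \<partial>?H) \<le> ennreal (C powr ?q)) sequentially"
      using C(2) by eventually_elim (use F p False C in \<open>simp add: Lp_star_le_iff\<close>)
    then have "limsup (\<lambda>k. \<integral>\<^sup>+t. ennreal (F k t powr ?q) \<partial>?H) \<le> ennreal (C powr ?q)"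
      by (rule Limsup_bounded)
    then show ?thesis
      using Liminf_le_Limsup[OF trivial_limit_sequentially] order_trans by blast
  qed
  finally show ?thesis
    using G p False C by (simp add: Lp_star_le_iff)
qed

lemma Lp_star_scale:
  assumes F: "F \<in> borel_measurable (orthant_measure n)" and p: "p \<ge> 1"
    and c: "\<And>j. j \<in> {1..n} \<Longrightarrow> c j > 0"
    and S: "(\<lambda>t. F (\<lambda>j\<in>{1..n}. c j * t j)) \<in> borel_measurable (orthant_measure n)"
  shows "Lp_star n p (\<lambda>t. F (\<lambda>j\<in>{1..n}. c j * t j)) = Lp_star n p F"
proof (cases "p = \<infinity>")
  case True
  have "(\<lambda>t. \<lambda>j\<in>{1..n}. c j * t j) ` pos_orthant n = pos_orthant n"
  proof safe
    fix t assume "t \<in> pos_orthant n"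
    then show "(\<lambda>j\<in>{1..n}. c j * t j) \<in> pos_orthant n"
      using scale_pos_orthant_iff[where c=c, OF c] by (auto simp: pos_orthant_def PiE_def)
  next
    fix t assume t: "t \<in> pos_orthant n"
    \<comment> \<open>Dividing by \<open>c\<close> gives a preimage of \<open>t\<close>; outside
      \<open>{1..n}\<close> both sides are \<open>undefined\<close>.\<close>
    have "t = (\<lambda>j\<in>{1..n}. c j * (\<lambda>j\<in>{1..n}. t j / c j) j)"
    proof
      fix j show "t j = (\<lambda>j\<in>{1..n}. c j * (\<lambda>j\<in>{1..n}. t j / c j) j) j"
        using t c[of j] by (auto simp: pos_orthant_def PiE_iff extensional_def)
    qed
    moreover have "(\<lambda>j\<in>{1..n}. t j / c j) \<in> pos_orthant n"
      using t c by (auto simp: pos_orthant_def PiE_iff)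
    ultimately show "t \<in> (\<lambda>t. \<lambda>j\<in>{1..n}. c j * t j) ` pos_orthant n"
      by (rule image_eqI)
  qed
  then have "(SUP t\<in>pos_orthant n. ennreal (F t)) =
      (SUP t\<in>(\<lambda>t. \<lambda>j\<in>{1..n}. c j * t j) ` pos_orthant n. ennreal (F t))"
    by simp
  also have "\<dots> = (SUP t\<in>pos_orthant n. ennreal (F (\<lambda>j\<in>{1..n}. c j * t j)))"
    by (simp add: image_image)
  finally show ?thesis
    using True by (simp add: Lp_star_def)
next
  case False
  have "(\<lambda>t. ennreal (F t powr enn2real p)) \<in> borel_measurable (orthant_measure n)"
    using F by measurable
  from nn_integral_orthant_measure_scale[where c=c, OF c this] show ?thesis
    by (simp only: Lp_star_finite[OF F False] Lp_star_finite[OF S False])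
qed

text \<open>Serves to make \<open>K_const\<close> a legitimate divisor. For infinite
  \<open>p\<close> the single point with all coordinates 1 decides.\<close>

lemma Lp_star_pos:
  assumes F: "F \<in> borel_measurable (orthant_measure n)" and p: "p \<ge> 1"
    and pos: "\<And>t. t \<in> pos_orthant n \<Longrightarrow> F t > 0"
  shows "Lp_star n p F > 0"
proof (rule ccontr)
  assume "\<not> ?thesis"
  then have 0: "Lp_star n p F \<le> ennreal 0"
    by simp
  show False
  proof (cases "p = \<infinity>")
    case True
    have "(\<lambda>j\<in>{1..n}. 1) \<in> pos_orthant n"
      by (auto simp: pos_orthant_def)
    then have "F (\<lambda>j\<in>{1..n}. 1) \<le> 0" "F (\<lambda>j\<in>{1..n}. 1) > 0"
      using 0 pos unfolding Lp_star_infinity_le_iff[OF True] by (auto simp: ennreal_eq_0_iff)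
    then show False
      by simp
  next
    case False
    have "(\<lambda>t. ennreal (F t powr enn2real p)) \<in> borel_measurable (orthant_measure n)"
      using F by measurable
    then have "(\<integral>\<^sup>+t. ennreal (F t powr enn2real p) \<partial>orthant_measure n) > 0"
      using less_imp_neq[OF pos] by (intro nn_integral_orthant_measure_pos) (auto simp: eq_commute[of 0])
    then show False
      using 0 by (simp only: Lp_star_le_iff[OF F p False order_refl]) simp
  qed
qed

section \<open>Normed spaces inside an ambient vector space\<close>

text \<open>A single interface for the members of a tuple, their sum and intersection, and the
  K-space.\<close>

locale normed_subspace = vector_space s
  for s :: "'k::real_normed_field \<Rightarrow> 'a::ab_group_add \<Rightarrow> 'a" +
  fixes X :: "'a nspace"
  assumes normed: "normed_space_on s X"
begin

lemma subspace_points: "subspace (points X)"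
  using normed by (simp add: normed_space_on_def)

lemmas mem_zero = subspace_0[OF subspace_points]
  and mem_add = subspace_add[OF subspace_points]
  and mem_diff = subspace_diff[OF subspace_points]
  and mem_scale = subspace_scale[OF subspace_points]
  and mem_sum = subspace_sum[OF subspace_points]

lemma nnorm_nonneg: "x \<in> points X \<Longrightarrow> nnorm X x \<ge> 0"
  and nnorm_eq_0_iff: "x \<in> points X \<Longrightarrow> nnorm X x = 0 \<longleftrightarrow> x = 0"
  and nnorm_scale: "x \<in> points X \<Longrightarrow> nnorm X (s c x) = norm c * nnorm X x"
  and nnorm_triangle: "x \<in> points X \<Longrightarrow> y \<in> points X \<Longrightarrow> nnorm X (x + y) \<le> nnorm X x + nnorm X y"
  using normed by (auto simp: normed_space_on_def)

lemma nnorm_0: "nnorm X 0 = 0"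
  using nnorm_eq_0_iff[OF mem_zero] by simp

lemma nnorm_sum: "(\<And>i. i \<in> I \<Longrightarrow> u i \<in> points X) \<Longrightarrow> nnorm X (sum u I) \<le> (\<Sum>i\<in>I. nnorm X (u i))"
proof (induction I rule: infinite_finite_induct)
  case (insert i I)
  then have "nnorm X (u i + sum u I) \<le> nnorm X (u i) + nnorm X (sum u I)"
    by (intro nnorm_triangle mem_sum) auto
  with insert show ?case
    by force
qed (simp_all add: nnorm_0)

sublocale metric: Metric_space "points X" "ndist X"
  by (rule Metric_space_ndist[OF vector_space_axioms normed])

lemma limitin_iff:
  assumes "\<And>k. \<sigma> k \<in> points X"
  shows "limitin (ntopology X) \<sigma> a sequentially \<longleftrightarrow>
    a \<in> points X \<and> (\<lambda>k. nnorm X (\<sigma> k - a)) \<longlonglongrightarrow> 0"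
proof (cases "a \<in> points X")
  case True
  then have "\<bar>nnorm X (\<sigma> k - a)\<bar> = ndist X (\<sigma> k) a" for k
    using assms nnorm_nonneg mem_diff by (simp add: ndist_def)
  then show ?thesis
    using True assms unfolding ntopology_def metric.limitin_metric tendsto_iff dist_real_def
    by simp
qed (simp add: ntopology_def metric.limitin_metric)

lemma MCauchy_iff:
  "metric.MCauchy \<sigma> \<longleftrightarrow> (\<forall>k. \<sigma> k \<in> points X) \<and>
    (\<forall>e>0. \<exists>N. \<forall>k l. N \<le> k \<longrightarrow> N \<le> l \<longrightarrow> nnorm X (\<sigma> k - \<sigma> l) < e)"
proof (cases "\<forall>k. \<sigma> k \<in> points X")
  case True
  then have "ndist X (\<sigma> k) (\<sigma> l) = nnorm X (\<sigma> k - \<sigma> l)" for k l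
    by (simp add: ndist_def)
  with True show ?thesis
    unfolding metric.MCauchy_def by auto
qed (auto simp: metric.MCauchy_def)

lemma banach_iff:
  "banach_space_on s X \<longleftrightarrow> (\<forall>\<sigma>. (\<forall>k. \<sigma> k \<in> points X) \<longrightarrow>
     (\<forall>e>0. \<exists>N. \<forall>k l. N \<le> k \<longrightarrow> N \<le> l \<longrightarrow> nnorm X (\<sigma> k - \<sigma> l) < e) \<longrightarrow>
     (\<exists>a\<in>points X. (\<lambda>k. nnorm X (\<sigma> k - a)) \<longlonglongrightarrow> 0))"
  unfolding banach_space_on_def metric.mcomplete_def MCauchy_iff
  using normed limitin_iff unfolding ntopology_def by blast

text \<open>A Cauchy sequence has a subsequence whose increments are below
  \<open>(1 / 2) ^ k\<close>. These increments form a telescoping series, so the subsequence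
  converges, and with it the whole sequence.\<close>

lemma banachI_series:
  assumes ser: "\<And>u. (\<And>k. u k \<in> points X) \<Longrightarrow> (\<And>k. nnorm X (u k) \<le> (1 / 2) ^ k) \<Longrightarrow>
    \<exists>a\<in>points X. (\<lambda>m. nnorm X ((\<Sum>i<m. u i) - a)) \<longlonglongrightarrow> 0"
  shows "banach_space_on s X"
  unfolding banach_space_on_def metric.mcomplete_def
proof (intro conjI allI impI normed)
  fix \<sigma> assume cauchy: "metric.MCauchy \<sigma>"
  then have mem: "\<sigma> k \<in> points X" for k
    by (simp add: MCauchy_iff)
  have "\<forall>k. \<exists>N. \<forall>l m. N \<le> l \<longrightarrow> N \<le> m \<longrightarrow> nnorm X (\<sigma> l - \<sigma> m) < (1 / 2) ^ k"
    using cauchy unfolding MCauchy_iff by (meson half_gt_zero_iff zero_less_one zero_less_power)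
  then obtain N where N: "\<And>k l m. N k \<le> l \<Longrightarrow> N k \<le> m \<Longrightarrow> nnorm X (\<sigma> l - \<sigma> m) < (1 / 2) ^ k"
    by metis
  \<comment> \<open>Partial sums of the \<open>Suc (N i)\<close> are strictly increasing and
    dominate each \<open>N k\<close>, which yields the indices of the subsequence in closed
    form.\<close>
  define r where "r k = (\<Sum>i\<le>k. Suc (N i))" for k
  have r: "strict_mono r"
    by (rule strict_monoI_Suc) (simp add: r_def)
  have rN: "N k \<le> r k" for k
    using member_le_sum[of k "{..k}" "\<lambda>i. Suc (N i)"] by (simp add: r_def)
  have rN': "N k \<le> r (Suc k)" for k
    using rN[of k] strict_monoD[OF r, of k "Suc k"] by simp
  obtain b where b: "b \<in> points X"
    "(\<lambda>m. nnorm X ((\<Sum>i<m. \<sigma> (r (Suc i)) - \<sigma> (r i)) - b)) \<longlonglongrightarrow> 0"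
    using ser[of "\<lambda>i. \<sigma> (r (Suc i)) - \<sigma> (r i)"] mem mem_diff N[OF rN' rN] by (force intro: less_imp_le)
  have "(\<Sum>i<m. \<sigma> (r (Suc i)) - \<sigma> (r i)) - b = (\<sigma> \<circ> r) m - (b + \<sigma> (r 0))" for m
    using sum_lessThan_telescope[of "\<lambda>i. \<sigma> (r i)" m] by (simp add: algebra_simps)
  with b(2) have "(\<lambda>m. nnorm X ((\<sigma> \<circ> r) m - (b + \<sigma> (r 0)))) \<longlonglongrightarrow> 0"
    by (simp only:)
  then have "limitin (ntopology X) (\<sigma> \<circ> r) (b + \<sigma> (r 0)) sequentially"
    using b(1) mem mem_add by (subst limitin_iff) simp_all
  then show "\<exists>a. limitin metric.mtopology \<sigma> a sequentially"
    using metric.MCauchy_convergent_subsequence[OF cauchy r] unfolding ntopology_def by blast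
qed

lemma banach_series_converges:
  assumes X: "banach_space_on s X"
    and u: "\<And>k. u k \<in> points X" "\<And>k. nnorm X (u k) \<le> (1 / 2) ^ k"
  shows "\<exists>a\<in>points X. (\<lambda>m. nnorm X ((\<Sum>i<m. u i) - a)) \<longlonglongrightarrow> 0"
proof -
  \<comment> \<open>Geometric tail estimate for ordered indices; the other order follows from the
    symmetry of the distance.\<close>
  have le: "nnorm X ((\<Sum>i<k. u i) - (\<Sum>i<l. u i)) \<le> 2 * (1 / 2) ^ l" if "l \<le> k" for k l
  proof -
    have "(\<Sum>i<k. u i) - (\<Sum>i<l. u i) = (\<Sum>i=l..<k. u i)"
      using that by (metis add_diff_cancel_left' lessThan_atLeast0 sum.atLeastLessThan_concat zero_le)
    moreover have "nnorm X (\<Sum>i=l..<k. u i) \<le> (\<Sum>i=l..<k. nnorm X (u i))"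
      using u by (intro nnorm_sum)
    moreover have "\<dots> \<le> (\<Sum>i=l..<k. (1 / 2) ^ i)"
      using u by (intro sum_mono)
    moreover have "(\<Sum>i=l..<k. (1 / 2 :: real) ^ i) = 2 * (1 / 2) ^ l - 2 * (1 / 2) ^ k"
      using that by (induction k rule: dec_induct) auto
    ultimately have "nnorm X ((\<Sum>i<k. u i) - (\<Sum>i<l. u i)) \<le> 2 * (1 / 2) ^ l - 2 * (1 / 2) ^ k"
      by simp
    also have "\<dots> \<le> 2 * (1 / 2) ^ l"
      by simp
    finally show ?thesis .
  qed
  have comm: "nnorm X (x - y) = nnorm X (y - x)" if "x \<in> points X" "y \<in> points X" for x y
    using metric.commute[of x y] that by (simp add: ndist_def)
  have mem: "(\<Sum>i<k. u i) \<in> points X" for k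
    using u by (intro mem_sum)
  have "\<exists>N. \<forall>k l. N \<le> k \<longrightarrow> N \<le> l \<longrightarrow> nnorm X ((\<Sum>i<k. u i) - (\<Sum>i<l. u i)) < e" if e: "e > 0" for e
  proof -
    have "(\<lambda>l. 2 * (1 / 2 :: real) ^ l) \<longlonglongrightarrow> 2 * 0"
      by (intro tendsto_mult tendsto_const LIMSEQ_realpow_zero) auto
    then have "eventually (\<lambda>l. 2 * (1 / 2 :: real) ^ l < e) sequentially"
      using e by (intro order_tendstoD(2)) auto
    then obtain N where N: "\<And>l. l \<ge> N \<Longrightarrow> 2 * (1 / 2 :: real) ^ l < e"
      unfolding eventually_sequentially by blast
    have "nnorm X ((\<Sum>i<k. u i) - (\<Sum>i<l. u i)) < e" if "N \<le> k" "N \<le> l" for k l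
    proof (cases "l \<le> k")
      case True
      with le[OF this] N[OF that(2)] show ?thesis by linarith
    next
      case False
      then show ?thesis
        using le[of k l] N[OF that(1)] comm[OF mem mem, of k l] by simp
    qed
    then show ?thesis by blast
  qed
  then show ?thesis
    using X[unfolded banach_iff, rule_format, of "\<lambda>k. \<Sum>i<k. u i"] mem by simp
qed

end

lemma continuous_inclusionI:
  assumes X: "normed_subspace s X" and Y: "normed_subspace s Y" and sub: "points X \<subseteq> points Y"
    and le: "\<And>x. x \<in> points X \<Longrightarrow> nnorm Y x \<le> C * nnorm X x"
  shows "continuous_inclusion X Y"
proof -
  interpret X: normed_subspace s X by fact
  interpret Y: normed_subspace s Y by fact
  note Mc = X.metric.metric_continuous_map[OF Y.metric.Metric_space_axioms]
  have "\<exists>d>0. \<forall>x. x \<in> points X \<and> ndist X a x < d \<longrightarrow> ndist Y a x < e"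
    if a: "a \<in> points X" and e: "e > 0" for a e
  proof (intro exI conjI allI impI; (elim conjE)?)
    \<comment> \<open>The constant \<open>C\<close> may be zero or negative, so
      \<open>\<bar>C\<bar> + 1\<close> takes its place as a positive divisor.\<close>
    show "e / (\<bar>C\<bar> + 1) > 0"
      using e by simp
    fix x assume x: "x \<in> points X" "ndist X a x < e / (\<bar>C\<bar> + 1)"
    have n: "nnorm X (a - x) \<ge> 0"
      using a x X.mem_diff X.nnorm_nonneg by blast
    have "ndist Y a x \<le> C * ndist X a x"
      using a x sub le[OF X.mem_diff] by (auto simp: ndist_def)
    also have "\<dots> \<le> (\<bar>C\<bar> + 1) * ndist X a x"
      by (intro mult_right_mono) auto
    also have "\<dots> < e"
      using x by (simp add: field_simps)
    finally show "ndist Y a x < e" .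
  qed
  then show ?thesis
    using sub unfolding continuous_inclusion_def ntopology_def Mc by auto
qed

section \<open>The K-functional\<close>

locale compatible_tuple =
  fixes n :: nat and s :: "'k::real_normed_field \<Rightarrow> 'a::{topological_ab_group_add, t2_space} \<Rightarrow> 'a"
    and A :: "nat \<Rightarrow> 'a nspace"
  assumes tuple: "banach_tuple n s A"
begin

sublocale vector_space s
  using tuple by (simp add: banach_tuple_def topological_vector_space_def)

lemma normed_subspace: "j \<le> n \<Longrightarrow> normed_subspace s (A j)"
  using tuple unfolding normed_subspace_def normed_subspace_axioms_def
  by (auto simp: vector_space_axioms banach_tuple_def banach_space_on_def)

lemmas mem_zero = normed_subspace.mem_zero[OF normed_subspace]
  and mem_add = normed_subspace.mem_add[OF normed_subspace]
  and mem_diff = normed_subspace.mem_diff[OF normed_subspace]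
  and mem_scale = normed_subspace.mem_scale[OF normed_subspace]
  and mem_sum = normed_subspace.mem_sum[OF normed_subspace]
  and nnorm_nonneg = normed_subspace.nnorm_nonneg[OF normed_subspace]
  and nnorm_triangle = normed_subspace.nnorm_triangle[OF normed_subspace]
  and nnorm_scale = normed_subspace.nnorm_scale[OF normed_subspace]
  and nnorm_0 = normed_subspace.nnorm_0[OF normed_subspace]
  and nnorm_eq_0_iff = normed_subspace.nnorm_eq_0_iff[OF normed_subspace]

abbreviation "S \<equiv> points (sum_space n A)"

lemma S_iff: "a \<in> S \<longleftrightarrow> decompositions n A a \<noteq> {}"
  by (simp add: sum_space_def)

lemma decomposition_mem: "x \<in> decompositions n A a \<Longrightarrow> j \<le> n \<Longrightarrow> x j \<in> points (A j)"
  by (simp add: decompositions_def)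

lemma decomposition_0: "(\<lambda>_. 0) \<in> decompositions n A 0"
  by (simp add: decompositions_def mem_zero)

lemma decomposition_add:
  "x \<in> decompositions n A a \<Longrightarrow> y \<in> decompositions n A b \<Longrightarrow> (\<lambda>j. x j + y j) \<in> decompositions n A (a + b)"
  by (simp add: decompositions_def mem_add sum.distrib)

lemma decomposition_scale:
  "x \<in> decompositions n A a \<Longrightarrow> (\<lambda>j. s c (x j)) \<in> decompositions n A (s c a)"
  by (auto simp: decompositions_def mem_scale scale_sum_right)

lemma subspace_S: "subspace S"
proof (rule subspaceI)
  show "0 \<in> S"
    using decomposition_0 by (auto simp: S_iff)
  show "a + b \<in> S" if "a \<in> S" "b \<in> S" for a b
    using that decomposition_add[of _ a _ b] by (auto simp: S_iff)
  show "s c a \<in> S" if "a \<in> S" for c a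
    using that decomposition_scale[of _ a c] by (auto simp: S_iff)
qed

lemma S_diff: "a \<in> S \<Longrightarrow> b \<in> S \<Longrightarrow> a - b \<in> S"
  by (rule subspace_diff[OF subspace_S])

section \<open>The K-functional for fixed nonnegative weights, as a function of the element\<close>

context
  fixes w :: "nat \<Rightarrow> real"
  assumes w: "\<And>j. j \<le> n \<Longrightarrow> w j \<ge> 0"
begin

lemma weighted_sum_nonneg: "x \<in> decompositions n A a \<Longrightarrow> (\<Sum>j\<le>n. w j * nnorm (A j) (x j)) \<ge> 0"
  using w by (intro sum_nonneg mult_nonneg_nonneg nnorm_nonneg decomposition_mem) auto

lemma K_le: "x \<in> decompositions n A a \<Longrightarrow> K_functional n A w a \<le> (\<Sum>j\<le>n. w j * nnorm (A j) (x j))"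
  unfolding K_functional_def using weighted_sum_nonneg
  by (intro cINF_lower bdd_belowI2[where m=0]) auto

text \<open>Membership in \<open>S\<close> rules out the infimum over the empty set, about whose
  real value nothing is known.\<close>

lemma K_greatest:
  assumes "a \<in> S" "\<And>x. x \<in> decompositions n A a \<Longrightarrow> c \<le> (\<Sum>j\<le>n. w j * nnorm (A j) (x j))"
  shows "c \<le> K_functional n A w a"
  using assms unfolding K_functional_def S_iff by (intro cINF_greatest) auto

lemma K_nonneg: "a \<in> S \<Longrightarrow> K_functional n A w a \<ge> 0"
  using weighted_sum_nonneg by (intro K_greatest)

lemma K_approx:
  assumes "a \<in> S" "e > 0"
  obtains x where "x \<in> decompositions n A a"
    "(\<Sum>j\<le>n. w j * nnorm (A j) (x j)) < K_functional n A w a + e"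
proof -
  have "\<not> K_functional n A w a + e \<le> K_functional n A w a"
    using assms by simp
  then show ?thesis
    using K_greatest[OF assms(1), of "K_functional n A w a + e"] that by (meson not_le)
qed

lemma K_triangle:
  assumes a: "a \<in> S" and b: "b \<in> S"
  shows "K_functional n A w (a + b) \<le> K_functional n A w a + K_functional n A w b"
proof (rule field_le_epsilon)
  fix e :: real assume "e > 0"
  then have e: "e / 2 > 0" by simp
  obtain x where x: "x \<in> decompositions n A a"
    "(\<Sum>j\<le>n. w j * nnorm (A j) (x j)) < K_functional n A w a + e / 2"
    using K_approx[OF a e] .
  obtain y where y: "y \<in> decompositions n A b"
    "(\<Sum>j\<le>n. w j * nnorm (A j) (y j)) < K_functional n A w b + e / 2"
    using K_approx[OF b e] .
  have "K_functional n A w (a + b) \<le> (\<Sum>j\<le>n. w j * nnorm (A j) (x j + y j))"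
    by (rule K_le[OF decomposition_add[OF x(1) y(1)]])
  also have "\<dots> \<le> (\<Sum>j\<le>n. w j * (nnorm (A j) (x j) + nnorm (A j) (y j)))"
    using x y w by (intro sum_mono mult_left_mono nnorm_triangle decomposition_mem) auto
  also have "\<dots> = (\<Sum>j\<le>n. w j * nnorm (A j) (x j)) + (\<Sum>j\<le>n. w j * nnorm (A j) (y j))"
    by (simp add: distrib_left sum.distrib)
  finally show "K_functional n A w (a + b) \<le> K_functional n A w a + K_functional n A w b + e"
    using x(2) y(2) by linarith
qed

lemma K_scale_le:
  assumes a: "a \<in> S"
  shows "K_functional n A w (s c a) \<le> norm c * K_functional n A w a"
proof (rule field_le_epsilon)
  fix e :: real assume e: "e > 0"
  \<comment> \<open>The summand 1 keeps the divisor positive when \<open>c = 0\<close>.\<close>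
  then have "e / (norm c + 1) > 0"
    by (intro divide_pos_pos) (auto intro: add_nonneg_pos)
  then obtain x where x: "x \<in> decompositions n A a"
    "(\<Sum>j\<le>n. w j * nnorm (A j) (x j)) < K_functional n A w a + e / (norm c + 1)"
    using K_approx[OF a] by blast
  have "K_functional n A w (s c a) \<le> (\<Sum>j\<le>n. w j * nnorm (A j) (s c (x j)))"
    by (rule K_le[OF decomposition_scale[OF x(1)]])
  also have "\<dots> = (\<Sum>j\<le>n. norm c * (w j * nnorm (A j) (x j)))"
    using decomposition_mem[OF x(1)] by (intro sum.cong) (auto simp: nnorm_scale)
  also have "\<dots> \<le> norm c * (K_functional n A w a + e / (norm c + 1))"
    unfolding sum_distrib_left[symmetric] using x(2) by (intro mult_left_mono) auto
  also have "\<dots> \<le> norm c * K_functional n A w a + e"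
  proof -
    have "norm c + 1 > 0"
      by (intro add_nonneg_pos) auto
    then have "norm c * (e / (norm c + 1)) \<le> e"
      using e by (simp add: field_simps)
    then show ?thesis
      by (simp add: distrib_left)
  qed
  finally show "K_functional n A w (s c a) \<le> norm c * K_functional n A w a + e" .
qed

text \<open>For nonzero \<open>c\<close> the reverse inequality is \<open>K_scale_le\<close> for
  \<open>inverse c\<close>, applied to \<open>s c a\<close>.\<close>

lemma K_scale:
  assumes a: "a \<in> S"
  shows "K_functional n A w (s c a) = norm c * K_functional n A w a"
proof (cases "c = 0")
  case True
  then show ?thesis
    using K_scale_le[OF a, of c] K_nonneg[of "s c a"] subspace_scale[OF subspace_S a, of c] by simp
next
  case False
  have "K_functional n A w (s (inverse c) (s c a)) \<le> norm (inverse c) * K_functional n A w (s c a)"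
    by (rule K_scale_le[OF subspace_scale[OF subspace_S a]])
  then have "K_functional n A w a \<le> inverse (norm c) * K_functional n A w (s c a)"
    using False by (simp only: scale_scale left_inverse scale_one norm_inverse simp_thms)
  then have "norm c * K_functional n A w a \<le> norm c * (inverse (norm c) * K_functional n A w (s c a))"
    by (intro mult_left_mono) auto
  also have "\<dots> = K_functional n A w (s c a)"
    using False by simp
  finally show ?thesis
    using K_scale_le[OF a, of c] by simp
qed

lemma K_0: "K_functional n A w 0 = 0"
  using K_scale[OF subspace_0[OF subspace_S], of 0] by simp

text \<open>Monotonicity and homogeneity in the weights at once, read off decomposition by
  decomposition. Later comparisons of K for the same tuple at two weight vectors are instances of
  it.\<close>

lemma K_le_cmult:
  assumes a: "a \<in> S" and v: "\<And>j. j \<le> n \<Longrightarrow> v j \<ge> 0" and c: "c \<ge> 0"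
    and le: "\<And>j. j \<le> n \<Longrightarrow> v j \<le> c * w j"
  shows "K_functional n A v a \<le> c * K_functional n A w a"
proof (rule field_le_epsilon)
  fix e :: real assume e: "e > 0"
  then have "e / (c + 1) > 0"
    using c by simp
  then obtain x where x: "x \<in> decompositions n A a"
    "(\<Sum>j\<le>n. w j * nnorm (A j) (x j)) < K_functional n A w a + e / (c + 1)"
    using K_approx[OF a] by blast
  have "K_functional n A v a \<le> (\<Sum>j\<le>n. v j * nnorm (A j) (x j))"
    unfolding K_functional_def using v
    by (intro cINF_lower x(1) bdd_belowI2[where m=0] sum_nonneg mult_nonneg_nonneg nnorm_nonneg
        decomposition_mem) auto
  also have "\<dots> \<le> (\<Sum>j\<le>n. c * w j * nnorm (A j) (x j))"
    using x le by (intro sum_mono mult_right_mono nnorm_nonneg decomposition_mem) auto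
  also have "\<dots> = c * (\<Sum>j\<le>n. w j * nnorm (A j) (x j))"
    by (simp add: sum_distrib_left mult.assoc)
  also have "\<dots> \<le> c * (K_functional n A w a + e / (c + 1))"
    using x(2) c by (intro mult_left_mono) auto
  also have "\<dots> \<le> c * K_functional n A w a + e"
    using e c by (simp add: field_simps)
  finally show "K_functional n A v a \<le> c * K_functional n A w a + e" .
qed

end

lemma nnorm_sum_space: "nnorm (sum_space n A) a = K_functional n A (\<lambda>_. 1) a"
  by (simp add: sum_space_def K_functional_def)

lemma K_le_nnorm_sum_space:
  assumes "a \<in> S" "\<And>j. j \<le> n \<Longrightarrow> 0 \<le> w j" "\<And>j. j \<le> n \<Longrightarrow> w j \<le> c" "c \<ge> 0"
  shows "K_functional n A w a \<le> c * nnorm (sum_space n A) a"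
  unfolding nnorm_sum_space using assms by (intro K_le_cmult) auto

section \<open>The sum space as a Banach space\<close>

lemma tendsto_ambient:
  assumes j: "j \<le> n" and x: "\<And>k. x k \<in> points (A j)" "a \<in> points (A j)"
    and lim: "(\<lambda>k. nnorm (A j) (x k - a)) \<longlonglongrightarrow> 0"
  shows "x \<longlonglongrightarrow> a"
proof -
  have "limitin (ntopology (A j)) x a sequentially"
    using normed_subspace.limitin_iff[OF normed_subspace[OF j], of x] x lim by simp
  moreover have "continuous_map (ntopology (A j)) euclidean (\<lambda>x. x)"
    using tuple j by (simp add: banach_tuple_def)
  ultimately have "limitin euclidean ((\<lambda>x. x) \<circ> x) a sequentially"
    by (rule continuous_map_limit[rotated])
  then show ?thesis
    by (simp add: o_def)
qed

text \<open>Here the common ambient space matters. Decompositions of \<open>a\<close> with total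
  norm tending to 0 have components tending to 0 in each member, hence in the ambient topology.
  Their sum is constantly \<open>a\<close>, and limits in a Hausdorff space are unique.\<close>

lemma K_1_eq_0_imp_0:
  assumes a: "a \<in> S" and 0: "K_functional n A (\<lambda>_. 1) a = 0"
  shows "a = 0"
proof -
  have "\<exists>x. x \<in> decompositions n A a \<and> (\<Sum>j\<le>n. nnorm (A j) (x j)) < inverse (real (Suc k))" for k
    using K_approx[where w="\<lambda>_. 1", OF _ a, of "inverse (real (Suc k))"] 0 by (auto simp del: of_nat_Suc)
  then obtain x where x: "\<And>k. x k \<in> decompositions n A a"
    "\<And>k. (\<Sum>j\<le>n. nnorm (A j) (x k j)) < inverse (real (Suc k))"
    by metis
  have "(\<lambda>k. x k j) \<longlonglongrightarrow> 0" if j: "j \<le> n" for j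
  proof (rule tendsto_ambient[OF j])
    show "x k j \<in> points (A j)" for k
      by (rule decomposition_mem[OF x(1) j])
    show "(\<lambda>k. nnorm (A j) (x k j - 0)) \<longlonglongrightarrow> 0"
    proof (rule tendsto_sandwich[OF _ _ tendsto_const LIMSEQ_inverse_real_of_nat])
      show "eventually (\<lambda>k. 0 \<le> nnorm (A j) (x k j - 0)) sequentially"
        using nnorm_nonneg[OF j decomposition_mem[OF x(1) j]] by simp
      have "nnorm (A j) (x k j) \<le> (\<Sum>j\<le>n. nnorm (A j) (x k j))" for k
        using j by (intro member_le_sum nnorm_nonneg decomposition_mem[OF x(1)]) auto
      then show "eventually (\<lambda>k. nnorm (A j) (x k j - 0) \<le> inverse (real (Suc k))) sequentially"
        using x(2) by (intro always_eventually allI) (metis diff_zero less_imp_le order_le_less_trans)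
    qed
  qed (use mem_zero[OF j] in auto)
  then have "(\<lambda>k. \<Sum>j\<le>n. x k j) \<longlonglongrightarrow> (\<Sum>j\<le>n. 0)"
    by (intro tendsto_sum) auto
  moreover have "(\<Sum>j\<le>n. x k j) = a" for k
    using x(1)[of k] by (simp add: decompositions_def)
  ultimately show "a = 0"
    by (simp add: tendsto_const_iff)
qed

lemma normed_subspace_sum_space: "normed_subspace s (sum_space n A)"
proof
  note K1 = K_nonneg[where w="\<lambda>_. 1", OF zero_le_one] K_0[where w="\<lambda>_. 1", OF zero_le_one]
    K_scale[where w="\<lambda>_. 1", OF zero_le_one] K_triangle[where w="\<lambda>_. 1", OF zero_le_one]
  show "normed_space_on s (sum_space n A)"
    unfolding normed_space_on_def nnorm_sum_space
    by (intro conjI ballI allI iffI subspace_S K1 K_1_eq_0_imp_0) (simp_all add: K1)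
qed

text \<open>By the series criterion it suffices to sum terms of geometrically decreasing norm.
  Near-optimal decompositions of the terms give, in each \<open>A j\<close>, an absolutely summable
  series; the limits of these component series add up to the limit sought.\<close>

lemma banach_sum_space: "banach_space_on s (sum_space n A)"
proof (rule normed_subspace.banachI_series[OF normed_subspace_sum_space])
  fix u assume u: "\<And>k. u k \<in> S" "\<And>k. nnorm (sum_space n A) (u k) \<le> (1 / 2) ^ k"
  txt \<open>Halving \<open>u k\<close> leaves room for a near-optimal decomposition within \<open>(1 / 2) ^ k\<close>.\<close>
  have "\<exists>x. x \<in> decompositions n A (s (1 / 2) (u k)) \<and> (\<Sum>j\<le>n. nnorm (A j) (x j)) < (1 / 2) ^ k" for k
  proof -
    have S: "s (1 / 2) (u k) \<in> S"
      using u(1) by (rule subspace_scale[OF subspace_S])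
    have "K_functional n A (\<lambda>_. 1) (s (1 / 2) (u k)) \<le> (1 / 2) * (1 / 2) ^ k"
      using u(2)[of k] K_scale[OF _ u(1), of "\<lambda>_. 1" "1 / 2" k] by (simp add: nnorm_sum_space norm_divide)
    moreover have "(1 / 2) * (1 / 2 :: real) ^ k > 0"
      by simp
    from K_approx[OF _ S this, of "\<lambda>_. 1"] obtain x where
      "x \<in> decompositions n A (s (1 / 2) (u k))"
      "(\<Sum>j\<le>n. 1 * nnorm (A j) (x j)) < K_functional n A (\<lambda>_. 1) (s (1 / 2) (u k)) + (1 / 2) * (1 / 2) ^ k"
      by auto
    ultimately show ?thesis
      by (intro exI[of _ x]) auto
  qed
  then obtain x where x: "\<And>k. x k \<in> decompositions n A (s (1 / 2) (u k))"
    "\<And>k. (\<Sum>j\<le>n. nnorm (A j) (x k j)) < (1 / 2) ^ k"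
    by metis
  have xm: "x k j \<in> points (A j)" if "j \<le> n" for j k
    by (rule decomposition_mem[OF x(1) that])
  have "\<exists>y\<in>points (A j). (\<lambda>m. nnorm (A j) ((\<Sum>k<m. x k j) - y)) \<longlonglongrightarrow> 0" if j: "j \<le> n" for j
  proof (rule normed_subspace.banach_series_converges[OF normed_subspace[OF j]])
    show "banach_space_on s (A j)"
      using tuple j by (simp add: banach_tuple_def)
    show "nnorm (A j) (x k j) \<le> (1 / 2) ^ k" for k
    proof -
      have "nnorm (A j) (x k j) \<le> (\<Sum>j\<le>n. nnorm (A j) (x k j))"
        using j by (intro member_le_sum nnorm_nonneg xm) auto
      with x(2)[of k] show ?thesis by linarith
    qed
  qed (rule xm[OF j])
  then obtain y where y: "\<And>j. j \<le> n \<Longrightarrow> y j \<in> points (A j)"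
    "\<And>j. j \<le> n \<Longrightarrow> (\<lambda>m. nnorm (A j) ((\<Sum>k<m. x k j) - y j)) \<longlonglongrightarrow> 0"
    by metis
  define b where "b = (\<Sum>j\<le>n. y j)"
  \<comment> \<open>The errors of the component series decompose the error of the halved series, so
    the sum of their norms bounds its norm.\<close>
  have dec: "(\<lambda>j. (\<Sum>k<m. x k j) - y j) \<in> decompositions n A ((\<Sum>k<m. s (1 / 2) (u k)) - b)" for m
  proof -
    have "(\<Sum>k<m. s (1 / 2) (u k)) = (\<Sum>k<m. \<Sum>j\<le>n. x k j)"
      using x(1) by (intro sum.cong) (auto simp: decompositions_def)
    also have "\<dots> = (\<Sum>j\<le>n. \<Sum>k<m. x k j)"
      by (rule sum.swap)
    finally show ?thesis
      using y(1) xm unfolding decompositions_def b_def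
      by (auto simp: sum_subtractf intro!: mem_diff mem_sum)
  qed
  have yb: "y \<in> decompositions n A b"
    using y(1) by (simp add: decompositions_def b_def)
  then have b: "b \<in> S"
    by (auto simp: S_iff)
  have "(\<lambda>m. nnorm (sum_space n A) ((\<Sum>k<m. s (1 / 2) (u k)) - b)) \<longlonglongrightarrow> 0"
  proof (rule tendsto_sandwich[OF _ _ tendsto_const])
    show "eventually (\<lambda>m. 0 \<le> nnorm (sum_space n A) ((\<Sum>k<m. s (1 / 2) (u k)) - b)) sequentially"
    proof (intro always_eventually allI)
      fix m
      have "(\<Sum>k<m. s (1 / 2) (u k)) - b \<in> S"
        using dec[of m] by (auto simp: S_iff)
      then show "0 \<le> nnorm (sum_space n A) ((\<Sum>k<m. s (1 / 2) (u k)) - b)"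
        unfolding nnorm_sum_space by (intro K_nonneg) auto
    qed
    show "eventually (\<lambda>m. nnorm (sum_space n A) ((\<Sum>k<m. s (1 / 2) (u k)) - b)
        \<le> (\<Sum>j\<le>n. nnorm (A j) ((\<Sum>k<m. x k j) - y j))) sequentially"
      using K_le[where w="\<lambda>_. 1", OF _ dec] by (simp add: nnorm_sum_space)
    have "(\<lambda>m. \<Sum>j\<le>n. nnorm (A j) ((\<Sum>k<m. x k j) - y j)) \<longlonglongrightarrow> (\<Sum>j\<le>n. 0)"
      using y(2) by (intro tendsto_sum) auto
    then show "(\<lambda>m. \<Sum>j\<le>n. nnorm (A j) ((\<Sum>k<m. x k j) - y j)) \<longlonglongrightarrow> 0"
      by simp
  qed
  then have lim: "(\<lambda>m. 2 * nnorm (sum_space n A) ((\<Sum>k<m. s (1 / 2) (u k)) - b)) \<longlonglongrightarrow> 0"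
    using tendsto_mult_right_zero by blast
  interpret \<Sigma>: normed_subspace s "sum_space n A"
    by (rule normed_subspace_sum_space)
  \<comment> \<open>The halving is undone: the original series converges to
    \<open>s 2 b\<close>.\<close>
  have "2 * nnorm (sum_space n A) ((\<Sum>k<m. s (1 / 2) (u k)) - b) = nnorm (sum_space n A) ((\<Sum>k<m. u k) - s 2 b)" for m
  proof -
    have "(\<Sum>k<m. u k) - s 2 b = s 2 ((\<Sum>k<m. s (1 / 2) (u k)) - b)"
      by (simp add: scale_right_diff_distrib scale_sum_right)
    moreover have "nnorm (sum_space n A) (s 2 ((\<Sum>k<m. s (1 / 2) (u k)) - b)) =
        norm (2 :: 'k) * nnorm (sum_space n A) ((\<Sum>k<m. s (1 / 2) (u k)) - b)"
      using dec by (intro \<Sigma>.nnorm_scale) (auto simp: S_iff)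
    ultimately show ?thesis
      by simp
  qed
  with lim have "(\<lambda>m. nnorm (sum_space n A) ((\<Sum>k<m. u k) - s 2 b)) \<longlonglongrightarrow> 0"
    by simp
  then show "\<exists>a\<in>S. (\<lambda>m. nnorm (sum_space n A) ((\<Sum>k<m. u k) - a)) \<longlonglongrightarrow> 0"
    using subspace_scale[OF subspace_S b] by blast
qed

text \<open>
  The infimum over decompositions is uncountable; bounding the norms of the summands by rational
  numbers makes it countable, hence measurable in the weights.
\<close>

lemma K_eq_countable_INF:
  assumes a: "a \<in> S" and w: "\<And>j. j \<le> n \<Longrightarrow> w j \<ge> 0"
  shows "K_functional n A w a =
    (INF q\<in>{q \<in> PiE {..n} (\<lambda>_. \<rat>). \<exists>x\<in>decompositions n A a. \<forall>j\<le>n. nnorm (A j) (x j) \<le> q j}. \<Sum>j\<le>n. w j * q j)"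
    (is "_ = (INF q\<in>?Q. ?f q)")
proof (rule sym, rule cInf_eq_non_empty)
  have rat: "\<exists>q\<in>?Q. \<forall>j\<le>n. q j \<le> nnorm (A j) (x j) + d" if x: "x \<in> decompositions n A a" and d: "d > 0" for x d
  proof -
    have "\<exists>q\<in>\<rat>. nnorm (A j) (x j) < q \<and> q < nnorm (A j) (x j) + d" for j
      using Rats_dense_in_real[of "nnorm (A j) (x j)" "nnorm (A j) (x j) + d"] d by auto
    then obtain q where q: "\<And>j. q j \<in> \<rat>" "\<And>j. nnorm (A j) (x j) < q j" "\<And>j. q j < nnorm (A j) (x j) + d"
      by metis
    have "(\<lambda>j\<in>{..n}. q j) \<in> ?Q"
      using q x by (auto intro!: bexI[of _ x] less_imp_le)
    moreover have "\<forall>j\<le>n. (\<lambda>j\<in>{..n}. q j) j \<le> nnorm (A j) (x j) + d"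
      using q(3) by (simp add: less_imp_le)
    ultimately show ?thesis by blast
  qed
  obtain x0 where "x0 \<in> decompositions n A a"
    using a by (auto simp: S_iff)
  from rat[OF this zero_less_one] show "?f ` ?Q \<noteq> {}"
    by auto
  show "K_functional n A w a \<le> y" if y: "y \<in> ?f ` ?Q" for y
  proof -
    obtain q x where q: "y = ?f q" "x \<in> decompositions n A a" "\<And>j. j \<le> n \<Longrightarrow> nnorm (A j) (x j) \<le> q j"
      using y by auto
    have "K_functional n A w a \<le> (\<Sum>j\<le>n. w j * nnorm (A j) (x j))"
      using w q(2) by (intro K_le)
    also have "\<dots> \<le> ?f q"
      using w q(3) by (intro sum_mono mult_left_mono) auto
    finally show ?thesis
      using q(1) by simp
  qed
  fix z assume z: "\<And>y. y \<in> ?f ` ?Q \<Longrightarrow> z \<le> y"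
  show "z \<le> K_functional n A w a"
  proof (rule field_le_epsilon)
    fix e :: real assume e: "e > 0"
    \<comment> \<open>The summand 1 keeps \<open>W\<close> positive when all weights vanish.
      Rational bounds exceeding the norms by at most \<open>e / 2 / W\<close> cost at most
      \<open>e / 2\<close> in the weighted sum; the other half of \<open>e\<close> pays for the
      near-optimal decomposition.\<close>
    define W where "W = (\<Sum>j\<le>n. w j) + 1"
    have W: "W > 0" "(\<Sum>j\<le>n. w j) \<le> W"
      using sum_nonneg[of "{..n}" w] w by (auto simp: W_def)
    obtain x where x: "x \<in> decompositions n A a"
      "(\<Sum>j\<le>n. w j * nnorm (A j) (x j)) < K_functional n A w a + e / 2"
      using K_approx[where w=w, OF w a, of "e / 2"] e by auto
    obtain q where q: "q \<in> ?Q" "\<And>j. j \<le> n \<Longrightarrow> q j \<le> nnorm (A j) (x j) + e / 2 / W"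
      using rat[OF x(1), of "e / 2 / W"] e W by auto
    have "z \<le> ?f q"
      using q(1) z by blast
    also have "\<dots> \<le> (\<Sum>j\<le>n. w j * (nnorm (A j) (x j) + e / 2 / W))"
      using q(2) w by (intro sum_mono mult_left_mono) auto
    also have "\<dots> = (\<Sum>j\<le>n. w j * nnorm (A j) (x j)) + (\<Sum>j\<le>n. w j) * (e / 2 / W)"
      by (simp only: distrib_left sum.distrib sum_distrib_right)
    also have "(\<Sum>j\<le>n. w j) * (e / 2 / W) \<le> W * (e / 2 / W)"
      using W e by (intro mult_right_mono) auto
    finally show "z \<le> K_functional n A w a + e"
      using x(2) W by simp
  qed
qed

lemma fun_upd_0_nonneg:
  assumes "t \<in> pos_orthant n" "j \<le> n"
  shows "(t(0 := 1)) j > (0::real)"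
  using assms by (auto simp: pos_orthant_def PiE_iff)

text \<open>On the orthant K is the infimum of countably many affine functions of \<open>t\<close>,
  which are bounded below by 0 because each \<open>q j\<close> dominates a norm.\<close>

lemma measurable_K:
  assumes a: "a \<in> S"
  shows "(\<lambda>t. K_functional n A (t(0 := 1)) a) \<in> borel_measurable (orthant_measure n)"
proof -
  let ?Q = "{q \<in> PiE {..n} (\<lambda>_. \<rat>). \<exists>x\<in>decompositions n A a. \<forall>j\<le>n. nnorm (A j) (x j) \<le> q j}"
  have "(\<lambda>t. INF q\<in>?Q. \<Sum>j\<le>n. (t(0 := 1)) j * q j) \<in> borel_measurable (orthant_measure n)"
  proof (rule borel_measurable_cINF)
    show "countable ?Q"
      by (rule countable_subset[of _ "PiE {..n} (\<lambda>_. \<rat>)"]) (auto intro!: countable_PiE countable_rat)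
    show "(\<lambda>t. \<Sum>j\<le>n. (t(0 := 1)) j * q j) \<in> borel_measurable (orthant_measure n)" for q
    proof (rule borel_measurable_sum)
      fix j assume "j \<in> {..n}"
      then show "(\<lambda>t. (t(0 := 1)) j * q j) \<in> borel_measurable (orthant_measure n)"
        by (cases "j = 0") (auto intro!: borel_measurable_times measurable_orthant_component)
    qed
    show "bdd_below ((\<lambda>q. \<Sum>j\<le>n. (t(0 := 1)) j * q j) ` ?Q)" if "t \<in> space (orthant_measure n)" for t
    proof (rule bdd_belowI2[where m=0])
      fix q assume "q \<in> ?Q"
      then obtain x where "x \<in> decompositions n A a" "\<And>j. j \<le> n \<Longrightarrow> nnorm (A j) (x j) \<le> q j"
        by auto
      then have "q j \<ge> 0" if "j \<le> n" for j
        using nnorm_nonneg[OF that decomposition_mem] that by force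
      then show "(\<Sum>j\<le>n. (t(0 := 1)) j * q j) \<ge> 0"
        using that fun_upd_0_nonneg[of t]
        by (intro sum_nonneg mult_nonneg_nonneg) (auto intro: less_imp_le simp del: fun_upd_apply)
    qed
  qed
  also have "?this \<longleftrightarrow> ?thesis"
    using fun_upd_0_nonneg a
    by (intro measurable_cong K_eq_countable_INF[symmetric])
       (auto intro: less_imp_le simp del: fun_upd_apply)
  finally show ?thesis .
qed

end

section \<open>Boyd functions\<close>

lemma boyd_function_pos: "boyd_function \<phi> \<Longrightarrow> t > 0 \<Longrightarrow> \<phi> t > 0"
  by (simp add: boyd_function_def)

lemma boyd_bar_upper:
  assumes "boyd_function \<phi>" "t > 0" "s > 0"
  shows "\<phi> (t * s) \<le> boyd_bar \<phi> t * \<phi> s"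
proof -
  have "\<phi> (t * s) / \<phi> s \<le> boyd_bar \<phi> t"
    unfolding boyd_bar_def using assms by (intro cSUP_upper) (auto simp: boyd_function_def)
  then show ?thesis
    using boyd_function_pos[OF assms(1,3)] by (simp add: field_simps)
qed

text \<open>This is the quotient at \<open>s = 1\<close> in the supremum. It is the comparison
  through which the hypothesis on the \<open>\<phi> j\<close> controls their
  \<open>boyd_bar\<close>.\<close>

lemma boyd_le_boyd_bar: "boyd_function \<phi> \<Longrightarrow> t > 0 \<Longrightarrow> \<phi> t \<le> boyd_bar \<phi> t"
  using boyd_bar_upper[of \<phi> t 1] by (simp add: boyd_function_def)

lemma boyd_bar_pos: "boyd_function \<phi> \<Longrightarrow> t > 0 \<Longrightarrow> boyd_bar \<phi> t > 0"
  using boyd_le_boyd_bar boyd_function_pos by (metis order_less_le_trans)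

lemma measurable_boyd_function:
  "boyd_function \<phi> \<Longrightarrow> \<phi> \<in> borel_measurable (restrict_space borel {0<..})"
  by (intro borel_measurable_continuous_on_restrict) (simp add: boyd_function_def)

text \<open>\<open>boyd_bar \<phi>\<close> need not be continuous, but it is lower semicontinuous.\<close>

lemma measurable_boyd_bar:
  assumes \<phi>: "boyd_function \<phi>"
  shows "boyd_bar \<phi> \<in> borel_measurable (restrict_space borel {0<..})"
  unfolding borel_measurable_iff_greater
proof
  fix a
  \<comment> \<open>The union over \<open>s\<close> is uncountable, but each set in it is open, and
    openness survives arbitrary unions.\<close>
  have "{t \<in> {0<..}. a < boyd_bar \<phi> t} = (\<Union>s\<in>{0<..}. {0<..} \<inter> (\<lambda>t. \<phi> (t * s) / \<phi> s) -` {a<..})"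
    unfolding boyd_bar_def using \<phi> by (auto simp: less_cSUP_iff boyd_function_def)
  moreover have "open \<dots>"
  proof (intro open_UN ballI continuous_open_preimage)
    fix s :: real assume s: "s \<in> {0<..}"
    have "continuous_on {0<..} \<phi>"
      using \<phi> by (simp add: boyd_function_def)
    then have "continuous_on {0<..} (\<lambda>t. \<phi> (t * s))"
      by (rule continuous_on_compose2) (use s in \<open>auto intro!: continuous_intros\<close>)
    then show "continuous_on {0<..} (\<lambda>t. \<phi> (t * s) / \<phi> s)"
      using boyd_function_pos[OF \<phi>, of s] s by (intro continuous_intros) auto
  qed auto
  ultimately show "{t \<in> space (restrict_space borel {0<..}). a < boyd_bar \<phi> t} \<in> sets (restrict_space borel {0<..})"
    by (auto simp: space_restrict_space sets_restrict_space_iff)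
qed

section \<open>The K-method\<close>

locale K_parameters =
  fixes n :: nat and p :: ennreal and \<phi> :: "nat \<Rightarrow> real \<Rightarrow> real"
  assumes p: "p \<ge> 1"
    and boyd: "\<And>j. j \<in> {1..n} \<Longrightarrow> boyd_function (\<phi> j)"
    and finite_Lp: "Lp_star n p (\<lambda>t. Min (insert 1 (t ` {1..n})) / (\<Prod>j=1..n. \<phi> j (t j))) < \<infinity>"
begin

lemma pos_orthantD: "t \<in> pos_orthant n \<Longrightarrow> j \<in> {1..n} \<Longrightarrow> t j > 0"
  by (auto simp: pos_orthant_def PiE_iff)

lemma weight_pos: "(\<And>j. j \<in> {1..n} \<Longrightarrow> t j > 0) \<Longrightarrow> (\<Prod>j=1..n. \<phi> j (t j)) > 0"
  by (intro prod_pos boyd_function_pos[OF boyd]) auto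

lemma boyd_bar_weight_pos: "(\<And>j. j \<in> {1..n} \<Longrightarrow> t j > 0) \<Longrightarrow> (\<Prod>j=1..n. boyd_bar (\<phi> j) (t j)) > 0"
  by (intro prod_pos boyd_bar_pos[OF boyd]) auto

lemma weight_mult_le:
  assumes "\<And>j. j \<in> {1..n} \<Longrightarrow> u j > 0" "\<And>j. j \<in> {1..n} \<Longrightarrow> t j > 0"
  shows "(\<Prod>j=1..n. \<phi> j (u j * t j)) \<le> (\<Prod>j=1..n. boyd_bar (\<phi> j) (u j)) * (\<Prod>j=1..n. \<phi> j (t j))"
  unfolding prod.distrib[symmetric]
  using assms by (intro prod_mono conjI boyd_bar_upper boyd less_imp_le[OF boyd_function_pos[OF boyd]] mult_pos_pos)

lemma measurable_prod_components:
  assumes "\<And>j. j \<in> {1..n} \<Longrightarrow> f j \<in> borel_measurable (restrict_space borel {0::real<..})"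
  shows "(\<lambda>t. \<Prod>j=1..n. f j (t j) :: real) \<in> borel_measurable (orthant_measure n)"
proof (rule borel_measurable_prod)
  fix j assume j: "j \<in> {1..n}"
  then have "(\<lambda>t. t j) \<in> measurable (orthant_measure n) (restrict_space borel {0<..})"
    using measurable_orthant_component[OF j] by (intro measurable_restrict_space2) (auto intro: pos_orthantD)
  then show "(\<lambda>t. f j (t j)) \<in> borel_measurable (orthant_measure n)"
    using assms[OF j] by (rule measurable_compose)
qed

lemmas measurable_weight = measurable_prod_components[OF measurable_boyd_function[OF boyd]]
  and measurable_boyd_bar_weight = measurable_prod_components[OF measurable_boyd_bar[OF boyd]]

definition least :: "(nat \<Rightarrow> real) \<Rightarrow> real" where
  "least t = Min (insert 1 (t ` {1..n}))"

lemma finite_Lp_least: "Lp_star n p (\<lambda>t. least t / (\<Prod>j=1..n. \<phi> j (t j))) < \<infinity>"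
  using finite_Lp by (simp only: least_def)

lemma least_pos: "(\<And>j. j \<in> {1..n} \<Longrightarrow> t j > 0) \<Longrightarrow> least t > 0"
  by (simp add: least_def)

lemma least_le: "least t \<le> 1" "j \<in> {1..n} \<Longrightarrow> least t \<le> t j"
  unfolding least_def by (rule Min_le; simp)+

lemma measurable_least: "least \<in> borel_measurable (orthant_measure n)"
proof -
  \<comment> \<open>Index 0 stands for the entry 1, which turns the minimum into an infimum over a
    finite nonempty index set.\<close>
  have "(\<lambda>t. INF j\<in>{0..n}. if j = 0 then 1 else t j :: real) \<in> borel_measurable (orthant_measure n)"
  proof (rule borel_measurable_cINF)
    fix j assume "j \<in> {0..n}"
    then show "(\<lambda>t. if j = 0 then 1 else t j) \<in> borel_measurable (orthant_measure n)"
      by (cases "j = 0") (simp_all add: measurable_orthant_component)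
  qed auto
  moreover have "(INF j\<in>{0..n}. if j = 0 then 1 else t j) = least t" for t
  proof -
    have "(\<lambda>j. if j = 0 then 1 else t j) ` {0..n} = insert 1 (t ` {1..n})"
      by (auto simp: image_iff)
    then show ?thesis
      by (simp add: cInf_eq_Min least_def del: Min_insert)
  qed
  ultimately show ?thesis
    by simp
qed

text \<open>The number left over when the lower bound for a translated quotient is integrated over
  the translation \<open>u\<close>; its reciprocal is the constant in the pointwise bound for
  K.\<close>

definition K_const :: real where
  "K_const = enn2real (Lp_star n p (\<lambda>u. least u / (\<Prod>j=1..n. boyd_bar (\<phi> j) (u j))))"

text \<open>Passing to \<open>boyd_bar\<close> enlarges the denominator, so the norm stays below the
  finite one of the hypothesis; it is positive because the function is positive throughout the
  orthant.\<close>

lemma K_const: "K_const > 0"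
  "Lp_star n p (\<lambda>u. least u / (\<Prod>j=1..n. boyd_bar (\<phi> j) (u j))) = ennreal K_const"
proof -
  let ?G = "\<lambda>u. least u / (\<Prod>j=1..n. boyd_bar (\<phi> j) (u j))"
  have pos: "?G u > 0" if "u \<in> pos_orthant n" for u
    using that pos_orthantD by (intro divide_pos_pos least_pos boyd_bar_weight_pos) auto
  have m: "?G \<in> borel_measurable (orthant_measure n)"
    using measurable_least measurable_boyd_bar_weight by (rule borel_measurable_divide)
  have "Lp_star n p ?G \<le> Lp_star n p (\<lambda>t. least t / (\<Prod>j=1..n. \<phi> j (t j)))"
  proof (rule Lp_star_mono[OF m _ p])
    show "(\<lambda>t. least t / (\<Prod>j=1..n. \<phi> j (t j))) \<in> borel_measurable (orthant_measure n)"
      using measurable_least measurable_weight by (rule borel_measurable_divide)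
    fix u assume u: "u \<in> pos_orthant n"
    show "0 \<le> ?G u"
      using pos[OF u] by simp
    have "(\<Prod>j=1..n. \<phi> j (u j)) \<le> (\<Prod>j=1..n. boyd_bar (\<phi> j) (u j))"
      using pos_orthantD[OF u]
      by (intro prod_mono conjI boyd_le_boyd_bar[OF boyd] less_imp_le[OF boyd_function_pos[OF boyd]])
    then show "?G u \<le> least u / (\<Prod>j=1..n. \<phi> j (u j))"
      using less_imp_le[OF least_pos[OF pos_orthantD[OF u]]] weight_pos[OF pos_orthantD[OF u]]
      by (intro divide_left_mono mult_pos_pos boyd_bar_weight_pos pos_orthantD[OF u])
  qed
  then have "Lp_star n p ?G < \<infinity>"
    using finite_Lp_least by simp
  moreover have "Lp_star n p ?G > 0"
    using m p pos by (rule Lp_star_pos)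
  ultimately show "K_const > 0" "Lp_star n p ?G = ennreal K_const"
    by (auto simp: K_const_def enn2real_positive_iff)
qed

end

locale K_method = K_parameters n p \<phi> + compatible_tuple n s A
  for n p \<phi> and s :: "'k::real_normed_field \<Rightarrow> 'a::{topological_ab_group_add, t2_space} \<Rightarrow> 'a" and A
begin

abbreviation "K t a \<equiv> K_functional n A (t(0 := 1)) a"
abbreviation "X \<equiv> K_space n p \<phi> A"

definition quot :: "'a \<Rightarrow> (nat \<Rightarrow> real) \<Rightarrow> real" where
  "quot a t = K t a / (\<Prod>j=1..n. \<phi> j (t j))"

lemma upd_nonneg: "(\<And>j. j \<in> {1..n} \<Longrightarrow> t j > 0) \<Longrightarrow> j \<le> n \<Longrightarrow> (t(0 := 1)) j \<ge> (0::real)"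
  by (cases "j = 0") (auto intro: less_imp_le)

lemma upd_nonneg': "t \<in> pos_orthant n \<Longrightarrow> j \<le> n \<Longrightarrow> (t(0 := 1)) j \<ge> (0::real)"
  by (rule upd_nonneg[OF pos_orthantD])

lemma quot_nonneg: "a \<in> S \<Longrightarrow> t \<in> pos_orthant n \<Longrightarrow> quot a t \<ge> 0"
  unfolding quot_def using weight_pos[of t] pos_orthantD by (intro divide_nonneg_pos K_nonneg upd_nonneg') auto

lemma measurable_quot: "a \<in> S \<Longrightarrow> quot a \<in> borel_measurable (orthant_measure n)"
  unfolding quot_def[abs_def] using measurable_K measurable_weight by (rule borel_measurable_divide)

lemma X_iff: "a \<in> points X \<longleftrightarrow> a \<in> S \<and> Lp_star n p (quot a) < \<infinity>"
  by (simp add: K_space_def K_enorm_def quot_def[abs_def])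

lemma nnorm_X: "nnorm X a = enn2real (Lp_star n p (quot a))"
  by (simp add: K_space_def K_enorm_def quot_def[abs_def])

lemma Lp_quot: "a \<in> points X \<Longrightarrow> Lp_star n p (quot a) = ennreal (nnorm X a)"
  by (simp add: X_iff nnorm_X)

lemma X_I:
  assumes "a \<in> S" "Lp_star n p (quot a) \<le> ennreal C" "C \<ge> 0"
  shows "a \<in> points X" "nnorm X a \<le> C"
  using assms order_le_less_trans[OF assms(2)] by (auto simp: X_iff nnorm_X enn2real_leI)

lemma measurable_quot_scale:
  assumes "a \<in> S" "\<And>j. j \<in> {1..n} \<Longrightarrow> c j > 0"
  shows "(\<lambda>t. quot a (\<lambda>j\<in>{1..n}. c j * t j)) \<in> borel_measurable (orthant_measure n)"
  using measurable_scale_orthant[where c=c, OF assms(2)] measurable_quot[OF assms(1)] by (rule measurable_compose)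

lemma K_le_nnorm_X:
  assumes a: "a \<in> points X" and t: "\<And>j. j \<in> {1..n} \<Longrightarrow> t j > 0"
  shows "K t a \<le> 1 / K_const * (\<Prod>j=1..n. \<phi> j (t j)) * nnorm X a"
proof -
  let ?G = "\<lambda>u. least u / (\<Prod>j=1..n. boyd_bar (\<phi> j) (u j))"
  let ?S = "\<lambda>u. \<lambda>j\<in>{1..n}. t j * u j"
  have aS: "a \<in> S"
    using a by (simp add: X_iff)
  have q0: "quot a t \<ge> 0"
    unfolding quot_def using t by (intro divide_nonneg_pos K_nonneg upd_nonneg weight_pos aS) auto
  have Gm: "?G \<in> borel_measurable (orthant_measure n)"
    using measurable_least measurable_boyd_bar_weight by (rule borel_measurable_divide)
  have G0: "?G u \<ge> 0" if "u \<in> pos_orthant n" for u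
    using that pos_orthantD by (intro divide_nonneg_pos less_imp_le[OF least_pos] boyd_bar_weight_pos) auto
  \<comment> \<open>The norm is taken in \<open>u\<close> with \<open>t\<close> fixed:
    \<open>quot a t\<close> is a constant factor, and \<open>K_const\<close> is the norm of the
    rest.\<close>
  have "ennreal (quot a t * K_const) = Lp_star n p (\<lambda>u. quot a t * ?G u)"
    using Lp_star_cmult[OF Gm p q0 G0] K_const ennreal_mult'[OF less_imp_le[OF K_const(1)], of "quot a t"]
    by (simp add: mult.commute)
  also have "\<dots> \<le> Lp_star n p (\<lambda>u. quot a (?S u))"
  proof (rule Lp_star_mono[OF _ _ p])
    show "(\<lambda>u. quot a t * ?G u) \<in> borel_measurable (orthant_measure n)"
      using Gm by (intro borel_measurable_times) auto
    show "(\<lambda>u. quot a (?S u)) \<in> borel_measurable (orthant_measure n)"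
      using aS t by (rule measurable_quot_scale)
    fix u assume u: "u \<in> pos_orthant n"
    show "0 \<le> quot a t * ?G u"
      using q0 G0[OF u] by (rule mult_nonneg_nonneg)
    have up: "u j > 0" if "j \<in> {1..n}" for j
      by (rule pos_orthantD[OF u that])
    have Sp: "?S u j > 0" if "j \<in> {1..n}" for j
      using t up that by simp
    have m: "least u > 0"
      by (rule least_pos[OF up])
    \<comment> \<open>The weights are compared coordinatewise: coordinate 0 uses
      \<open>least u \<le> 1\<close>, every other one \<open>least u \<le> u j\<close>.\<close>
    have "K t a \<le> 1 / least u * K (?S u) a"
    proof (rule K_le_cmult[OF upd_nonneg[OF Sp] aS upd_nonneg[OF t]])
      show "(t(0 := 1)) j \<le> 1 / least u * ((?S u)(0 := 1)) j" if "j \<le> n" for j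
      proof (cases "j = 0")
        case True
        then show ?thesis
          using m least_le(1)[of u] by simp
      next
        case False
        then have j: "j \<in> {1..n}"
          using that by auto
        have "t j * least u \<le> t j * u j"
          using t[OF j] least_le(2)[OF j, of u] by (intro mult_left_mono) auto
        then show ?thesis
          using False j m by (simp add: pos_le_divide_eq)
      qed
    qed (use m in auto)
    then have 1: "least u * K t a \<le> K (?S u) a"
      using m by (simp add: field_simps)
    have 2: "(\<Prod>j=1..n. \<phi> j (?S u j)) \<le> (\<Prod>j=1..n. boyd_bar (\<phi> j) (u j)) * (\<Prod>j=1..n. \<phi> j (t j))"
      using weight_mult_le[OF up t] by (simp add: mult.commute)
    have "quot a t * ?G u = (least u * K t a) / ((\<Prod>j=1..n. boyd_bar (\<phi> j) (u j)) * (\<Prod>j=1..n. \<phi> j (t j)))"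
      by (simp only: quot_def times_divide_times_eq mult.commute)
    also have "\<dots> \<le> quot a (?S u)"
      unfolding quot_def
    proof (rule frac_le[OF _ 1 weight_pos[OF Sp] 2])
      show "0 \<le> K (?S u) a"
        using Sp by (intro K_nonneg upd_nonneg aS)
    qed
    finally show "quot a t * ?G u \<le> quot a (?S u)" .
  qed
  also have "\<dots> = Lp_star n p (quot a)"
    using Lp_star_scale[OF measurable_quot[OF aS] p t measurable_quot_scale[OF aS t]] .
  also have "\<dots> = ennreal (nnorm X a)"
    by (rule Lp_quot[OF a])
  finally have "quot a t * K_const \<le> nnorm X a"
    by (simp add: nnorm_X)
  then show ?thesis
    using weight_pos[OF t] K_const(1) by (simp add: quot_def field_simps)
qed

lemma nnorm_sum_space_le:
  assumes a: "a \<in> points X"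
  shows "nnorm (sum_space n A) a \<le> 1 / K_const * nnorm X a"
proof -
  have "K_functional n A ((\<lambda>_. 1)(0 := 1)) a \<le> 1 / K_const * (\<Prod>j=1..n. \<phi> j 1) * nnorm X a"
    by (rule K_le_nnorm_X[OF a]) simp
  moreover have "(\<Prod>j=1..n. \<phi> j 1) = 1"
    using boyd by (intro prod.neutral) (auto simp: boyd_function_def)
  ultimately show ?thesis
    by (simp add: nnorm_sum_space fun_upd_idem)
qed

lemma nnorm_X_nonneg: "nnorm X a \<ge> 0"
  by (simp add: nnorm_X)

section \<open>Norm axioms and completeness of the K-space\<close>

lemma X_add:
  assumes "a \<in> points X" "b \<in> points X"
  shows "a + b \<in> points X" "nnorm X (a + b) \<le> nnorm X a + nnorm X b"
proof -
  have S: "a \<in> S" "b \<in> S" "a + b \<in> S"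
    using assms subspace_add[OF subspace_S] by (auto simp: X_iff)
  have "Lp_star n p (quot (a + b)) \<le> Lp_star n p (\<lambda>t. quot a t + quot b t)"
  proof (rule Lp_star_mono[OF _ _ p])
    show "quot (a + b) t \<le> quot a t + quot b t" if "t \<in> pos_orthant n" for t
      unfolding quot_def add_divide_distrib[symmetric] using that weight_pos[of t] S pos_orthantD
      by (intro divide_right_mono K_triangle upd_nonneg') (auto intro: less_imp_le)
  qed (use S quot_nonneg measurable_quot in \<open>auto intro!: borel_measurable_add\<close>)
  also have "\<dots> \<le> Lp_star n p (quot a) + Lp_star n p (quot b)"
    using S quot_nonneg measurable_quot p by (intro Lp_star_triangle) auto
  also have "\<dots> = ennreal (nnorm X a + nnorm X b)"
    using assms by (simp add: Lp_quot nnorm_X_nonneg)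
  finally have "Lp_star n p (quot (a + b)) \<le> ennreal (nnorm X a + nnorm X b)" .
  from X_I[OF S(3) this] show "a + b \<in> points X" "nnorm X (a + b) \<le> nnorm X a + nnorm X b"
    by (simp_all add: nnorm_X_nonneg)
qed

lemma X_scale:
  assumes "a \<in> points X"
  shows "s c a \<in> points X" "nnorm X (s c a) = norm c * nnorm X a"
proof -
  have S: "a \<in> S" "s c a \<in> S"
    using assms subspace_scale[OF subspace_S] by (auto simp: X_iff)
  have "Lp_star n p (quot (s c a)) = Lp_star n p (\<lambda>t. norm c * quot a t)"
  \<comment> \<open>Homogeneity of K is available only for nonnegative weights, so the two functions
    are compared on the orthant alone, by monotonicity in both directions.\<close>
  proof (rule antisym; rule Lp_star_mono[OF _ _ p])
    fix t assume t: "t \<in> pos_orthant n"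
    have "quot (s c a) t = norm c * quot a t"
      unfolding quot_def by (subst K_scale[OF upd_nonneg'[OF t] S(1)]) simp_all
    then show "quot (s c a) t \<le> norm c * quot a t" "norm c * quot a t \<le> quot (s c a) t"
      by simp_all
    show "0 \<le> quot (s c a) t" "0 \<le> norm c * quot a t"
      using quot_nonneg t S by (auto intro!: mult_nonneg_nonneg)
  qed (use measurable_quot S in \<open>auto intro!: borel_measurable_times\<close>)
  also have "\<dots> = ennreal (norm c) * Lp_star n p (quot a)"
    using measurable_quot S quot_nonneg p assms by (intro Lp_star_cmult) (auto simp: X_iff)
  also have "\<dots> = ennreal (norm c * nnorm X a)"
    using assms by (simp add: Lp_quot nnorm_X_nonneg ennreal_mult)
  finally show "s c a \<in> points X" "nnorm X (s c a) = norm c * nnorm X a"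
    using S nnorm_X_nonneg[of a] by (auto simp: X_iff nnorm_X)
qed

lemma X_0: "0 \<in> points X"
proof (rule X_I)
  show "0 \<in> S"
    by (rule subspace_0[OF subspace_S])
  \<comment> \<open>Writing zero as 0 times a function of finite norm lets
    \<open>Lp_star_cmult\<close> evaluate the norm for all \<open>p\<close> at once.\<close>
  have "Lp_star n p (quot 0) \<le> Lp_star n p (\<lambda>t. 0 * (least t / (\<Prod>j=1..n. \<phi> j (t j))))"
  proof (rule Lp_star_mono[OF measurable_quot[OF \<open>0 \<in> S\<close>] _ p])
    fix t assume t: "t \<in> pos_orthant n"
    have "quot 0 t = 0"
      unfolding quot_def by (subst K_0[OF upd_nonneg'[OF t]]) simp_all
    then show "0 \<le> quot 0 t" "quot 0 t \<le> 0 * (least t / (\<Prod>j=1..n. \<phi> j (t j)))"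
      by simp_all
  qed simp
  also have "\<dots> = 0"
    using Lp_star_cmult[where c=0, OF borel_measurable_divide[OF measurable_least measurable_weight] p]
      finite_Lp_least least_pos weight_pos pos_orthantD by (simp add: divide_nonneg_pos less_imp_le)
  finally show "Lp_star n p (quot 0) \<le> ennreal 0"
    by simp
qed simp

lemma normed_subspace_X: "normed_subspace s X"
proof
  \<comment> \<open>Definiteness is inherited from the sum space through the embedding, which avoids
    any almost-everywhere argument about \<open>quot a\<close>.\<close>
  have eq0: "a = 0" if "a \<in> points X" "nnorm X a = 0" for a
  proof (rule K_1_eq_0_imp_0)
    show "a \<in> S"
      using that by (simp add: X_iff)
    then have "K_functional n A (\<lambda>_. 1) a \<ge> 0"
      by (intro K_nonneg) auto
    then show "K_functional n A (\<lambda>_. 1) a = 0"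
      using nnorm_sum_space_le[OF that(1)] that(2) by (simp add: nnorm_sum_space)
  qed
  moreover have "nnorm X 0 = 0"
    using X_scale(2)[OF X_0, of 0] by simp
  ultimately show "normed_space_on s X"
    unfolding normed_space_on_def using X_0 X_add X_scale nnorm_X_nonneg by (auto intro!: subspaceI)
qed

text \<open>For fixed weights K is Lipschitz in the sum norm; the sum \<open>W\<close> of the
  weights dominates each of them and serves as the Lipschitz constant. This supplies the pointwise
  convergence to which Fatou's lemma is applied.\<close>

lemma tendsto_K:
  assumes b: "\<And>k. b k \<in> S" "a \<in> S" "(\<lambda>k. nnorm (sum_space n A) (b k - a)) \<longlonglongrightarrow> 0"
    and w: "\<And>j. j \<le> n \<Longrightarrow> w j \<ge> 0" and c: "c \<in> S"
  shows "(\<lambda>k. K_functional n A w (c - b k)) \<longlonglongrightarrow> K_functional n A w (c - a)"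
proof -
  define W where "W = (\<Sum>j\<le>n. w j)"
  have W: "w j \<le> W" "0 \<le> W" if "j \<le> n" for j
    using w that by (auto simp: W_def intro!: member_le_sum sum_nonneg)
  interpret \<Sigma>: normed_subspace s "sum_space n A"
    by (rule normed_subspace_sum_space)
  have d: "\<bar>K_functional n A w (c - b k) - K_functional n A w (c - a)\<bar> \<le> W * nnorm (sum_space n A) (b k - a)" for k
  proof -
    have neg: "nnorm (sum_space n A) (a - b k) = nnorm (sum_space n A) (b k - a)"
      using \<Sigma>.metric.commute[of a "b k"] b by (simp add: ndist_def)
    have "K_functional n A w ((c - a) + (a - b k)) \<le> K_functional n A w (c - a) + K_functional n A w (a - b k)"
      "K_functional n A w ((c - b k) + (b k - a)) \<le> K_functional n A w (c - b k) + K_functional n A w (b k - a)"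
      using w b c S_diff by (intro K_triangle; blast)+
    moreover have "K_functional n A w (a - b k) \<le> W * nnorm (sum_space n A) (a - b k)"
      "K_functional n A w (b k - a) \<le> W * nnorm (sum_space n A) (b k - a)"
      using w b S_diff W by (intro K_le_nnorm_sum_space; blast)+
    ultimately show ?thesis
      by (simp add: neg)
  qed
  have "(\<lambda>k. W * nnorm (sum_space n A) (b k - a)) \<longlonglongrightarrow> 0"
    using b(3) by (rule tendsto_mult_right_zero)
  then have "(\<lambda>k. K_functional n A w (c - b k) - K_functional n A w (c - a)) \<longlonglongrightarrow> 0"
    by (rule Lim_null_comparison[rotated]) (use d in simp)
  then show ?thesis
    by (simp add: LIM_zero_iff)
qed

lemma banach_X: "banach_space_on s X"
  unfolding normed_subspace.banach_iff[OF normed_subspace_X]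
proof (intro allI impI)
  fix \<sigma> :: "nat \<Rightarrow> 'a"
  assume mem: "\<forall>k. \<sigma> k \<in> points X"
    and cauchy: "\<forall>e>0. \<exists>N. \<forall>k l. N \<le> k \<longrightarrow> N \<le> l \<longrightarrow> nnorm X (\<sigma> k - \<sigma> l) < e"
  interpret X: normed_subspace s X
    by (rule normed_subspace_X)
  have S: "\<sigma> k \<in> S" for k
    using mem by (simp add: X_iff)
  have "\<exists>N. \<forall>k l. N \<le> k \<longrightarrow> N \<le> l \<longrightarrow> nnorm (sum_space n A) (\<sigma> k - \<sigma> l) < e" if "e > 0" for e
  proof -
    have "e * K_const > 0"
      using that K_const(1) by simp
    then obtain N where N: "\<And>k l. N \<le> k \<Longrightarrow> N \<le> l \<Longrightarrow> nnorm X (\<sigma> k - \<sigma> l) < e * K_const"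
      using cauchy[rule_format, of "e * K_const"] by auto
    have "nnorm (sum_space n A) (\<sigma> k - \<sigma> l) < e" if "N \<le> k" "N \<le> l" for k l
    proof -
      have "nnorm (sum_space n A) (\<sigma> k - \<sigma> l) \<le> 1 / K_const * nnorm X (\<sigma> k - \<sigma> l)"
        using mem X.mem_diff by (intro nnorm_sum_space_le) auto
      also have "\<dots> < e"
        using N[OF that] K_const(1) by (simp add: field_simps)
      finally show ?thesis .
    qed
    then show ?thesis by blast
  qed
  then obtain a where a: "a \<in> S" "(\<lambda>k. nnorm (sum_space n A) (\<sigma> k - a)) \<longlonglongrightarrow> 0"
    using banach_sum_space[unfolded normed_subspace.banach_iff[OF normed_subspace_sum_space],
        rule_format, of \<sigma>] S by auto
  \<comment> \<open>The Cauchy bound is passed to the limit in \<open>l\<close> with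
    \<open>k\<close> fixed. Membership of the difference comes along with the bound, and it later
    places \<open>a\<close> itself in the K-space, as
    \<open>\<sigma> N - (\<sigma> N - a)\<close>.\<close>
  have lim: "\<sigma> k - a \<in> points X \<and> nnorm X (\<sigma> k - a) \<le> e"
    if e: "e \<ge> 0" and N: "\<And>l. N \<le> l \<Longrightarrow> nnorm X (\<sigma> k - \<sigma> l) < e" for k e N
  proof -
    have "Lp_star n p (quot (\<sigma> k - a)) \<le> ennreal e"
    proof (rule Lp_star_Fatou[where F="\<lambda>l. quot (\<sigma> k - \<sigma> l)", OF _ p])
      show "quot (\<sigma> k - \<sigma> l) \<in> borel_measurable (orthant_measure n)" for l
        using S S_diff by (intro measurable_quot) auto
      show "0 \<le> quot (\<sigma> k - \<sigma> l) t" if "t \<in> pos_orthant n" for l t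
        using S S_diff that by (intro quot_nonneg) auto
      show "(\<lambda>l. quot (\<sigma> k - \<sigma> l) t) \<longlonglongrightarrow> quot (\<sigma> k - a) t" if t: "t \<in> pos_orthant n" for t
        unfolding quot_def
      proof (intro tendsto_divide tendsto_const)
        show "(\<lambda>l. K t (\<sigma> k - \<sigma> l)) \<longlonglongrightarrow> K t (\<sigma> k - a)"
          using S a upd_nonneg'[OF t] S[of k] by (rule tendsto_K)
        show "(\<Prod>j=1..n. \<phi> j (t j)) \<noteq> 0"
          using weight_pos[of t] pos_orthantD[OF t] by (metis less_irrefl)
      qed
      show "eventually (\<lambda>l. Lp_star n p (quot (\<sigma> k - \<sigma> l)) \<le> ennreal e) sequentially"
        unfolding eventually_sequentially
        using N mem X.mem_diff e by (intro exI[of _ N] allI impI) (auto simp: Lp_quot intro!: ennreal_leI less_imp_le)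
    qed (rule e)
    then show ?thesis
      using X_I[OF S_diff[OF S a(1)]] e by blast
  qed
  have "a \<in> points X"
  proof -
    obtain N where "\<And>l. N \<le> l \<Longrightarrow> nnorm X (\<sigma> N - \<sigma> l) < 1"
      using cauchy[rule_format, of 1] by auto
    then have "\<sigma> N - a \<in> points X"
      using lim[of 1 N N] by simp
    then have "\<sigma> N - (\<sigma> N - a) \<in> points X"
      by (rule X.mem_diff[OF mem[rule_format]])
    then show ?thesis
      by simp
  qed
  moreover have "(\<lambda>k. nnorm X (\<sigma> k - a)) \<longlonglongrightarrow> 0"
  proof (rule LIMSEQ_I)
    fix r :: real assume "r > 0"
    \<comment> \<open>The limit preserves only the weak inequality, so \<open>r / 2\<close> is used
      to end strictly below \<open>r\<close>.\<close>
    then obtain N where N: "\<And>k l. N \<le> k \<Longrightarrow> N \<le> l \<Longrightarrow> nnorm X (\<sigma> k - \<sigma> l) < r / 2"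
      using cauchy[rule_format, of "r / 2"] by auto
    have "norm (nnorm X (\<sigma> k - a) - 0) < r" if "N \<le> k" for k
      using lim[of "r / 2" N k] N[OF that] \<open>r > 0\<close> nnorm_X_nonneg by simp
    then show "\<exists>N. \<forall>k\<ge>N. norm (nnorm X (\<sigma> k - a) - 0) < r"
      by blast
  qed
  ultimately show "\<exists>a\<in>points X. (\<lambda>k. nnorm X (\<sigma> k - a)) \<longlonglongrightarrow> 0"
    by blast
qed

end

section \<open>The intersection as a normed space\<close>

context compatible_tuple
begin

abbreviation "I \<equiv> intersection_space n A"

lemma intersection_mem: "a \<in> points I \<Longrightarrow> j \<le> n \<Longrightarrow> a \<in> points (A j)"
  by (simp add: intersection_space_def)

lemma nnorm_intersection_ge: "j \<le> n \<Longrightarrow> nnorm (A j) a \<le> nnorm I a"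
  by (auto simp: intersection_space_def intro!: Max_ge)

text \<open>Replaces the maximum by one index realising it, so that homogeneity and the triangle
  inequality can be taken from a single member of the tuple.\<close>

lemma nnorm_intersection_attained: "\<exists>j\<le>n. nnorm I a = nnorm (A j) a"
proof -
  have "Max ((\<lambda>j. nnorm (A j) a) ` {..n}) \<in> (\<lambda>j. nnorm (A j) a) ` {..n}"
    by (intro Max_in) auto
  then obtain j where "Max ((\<lambda>j. nnorm (A j) a) ` {..n}) = nnorm (A j) a" "j \<in> {..n}"
    by (rule imageE)
  then show ?thesis
    by (auto simp: intersection_space_def)
qed

lemma normed_subspace_intersection: "normed_subspace s I"
proof
  have sub: "subspace (points I)"
    by (rule subspaceI) (simp_all add: intersection_space_def mem_zero mem_add mem_scale)
  have nonneg: "nnorm I a \<ge> 0" if "a \<in> points I" for a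
    using nnorm_nonneg[OF le0 intersection_mem[OF that le0]] nnorm_intersection_ge[OF le0, of a] by linarith
  have eq0: "a = 0" if "a \<in> points I" "nnorm I a = 0" for a
  proof -
    have "nnorm (A 0) a = 0"
      using nnorm_nonneg[OF le0 intersection_mem[OF that(1) le0]] nnorm_intersection_ge[OF le0, of a] that(2)
      by linarith
    then show ?thesis
      using nnorm_eq_0_iff[OF le0 intersection_mem[OF that(1) le0]] by simp
  qed
  have scale: "nnorm I (s c a) = norm c * nnorm I a" if a: "a \<in> points I" for c a
  proof -
    have eq: "nnorm (A j) (s c a) = norm c * nnorm (A j) a" if "j \<le> n" for j
      by (rule nnorm_scale[OF that intersection_mem[OF a that]])
    obtain j where j: "j \<le> n" "nnorm I (s c a) = nnorm (A j) (s c a)"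
      using nnorm_intersection_attained by blast
    obtain k where k: "k \<le> n" "nnorm I a = nnorm (A k) a"
      using nnorm_intersection_attained by blast
    show ?thesis
    proof (rule antisym)
      show "nnorm I (s c a) \<le> norm c * nnorm I a"
        using j eq[OF j(1)] nnorm_intersection_ge[OF j(1), of a] by (simp add: mult_left_mono)
      show "norm c * nnorm I a \<le> nnorm I (s c a)"
        using k eq[OF k(1)] nnorm_intersection_ge[OF k(1), of "s c a"] by simp
    qed
  qed
  have triangle: "nnorm I (a + b) \<le> nnorm I a + nnorm I b" if "a \<in> points I" "b \<in> points I" for a b
  proof -
    obtain j where j: "j \<le> n" "nnorm I (a + b) = nnorm (A j) (a + b)"
      using nnorm_intersection_attained by blast
    note j(2)
    also have "nnorm (A j) (a + b) \<le> nnorm (A j) a + nnorm (A j) b"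
      using j(1) that by (intro nnorm_triangle intersection_mem)
    also have "\<dots> \<le> nnorm I a + nnorm I b"
      using j(1) by (intro add_mono nnorm_intersection_ge)
    finally show ?thesis .
  qed
  have "nnorm I 0 = 0"
    using scale[OF subspace_0[OF sub], of 0] by simp
  then show "normed_space_on s I"
    unfolding normed_space_on_def using sub nonneg eq0 scale triangle by auto
qed

end

section \<open>The embeddings of the intersection and into the sum space\<close>

context K_method
begin

text \<open>The whole of \<open>a\<close> is put into the component \<open>i\<close> of least
  weight, with zeros elsewhere; index 0 carries the weight 1.\<close>

lemma K_le_intersection:
  assumes a: "a \<in> points I" and t: "\<And>j. j \<in> {1..n} \<Longrightarrow> t j > 0"
  shows "a \<in> S" "K t a \<le> least t * nnorm I a"
proof -
  have "least t \<in> insert 1 (t ` {1..n})"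
    unfolding least_def by (rule Min_in) auto
  then obtain i where i: "i \<le> n" "least t = (t(0 := 1)) i"
  proof (cases "least t = 1")
    case True
    then show ?thesis
      using that[of 0] by simp
  next
    case False
    then show ?thesis
      using that \<open>least t \<in> insert 1 (t ` {1..n})\<close> by fastforce
  qed
  have dec: "(\<lambda>j. if j = i then a else 0) \<in> decompositions n A a"
    using a i(1) by (simp add: decompositions_def mem_zero intersection_mem sum.delta)
  then show "a \<in> S"
    by (auto simp: S_iff)
  have "K t a \<le> (\<Sum>j\<le>n. (t(0 := 1)) j * nnorm (A j) (if j = i then a else 0))"
    by (rule K_le[OF upd_nonneg[OF t] dec])
  also have "\<dots> = (\<Sum>j\<le>n. if j = i then (t(0 := 1)) i * nnorm (A i) a else 0)"
    by (intro sum.cong) (auto simp: nnorm_0)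
  also have "\<dots> = least t * nnorm (A i) a"
    using i by simp
  also have "\<dots> \<le> least t * nnorm I a"
    using nnorm_intersection_ge[OF i(1)] least_pos[OF t] by (intro mult_left_mono) (auto intro: less_imp_le)
  finally show "K t a \<le> least t * nnorm I a" .
qed

lemma intersection_included: "continuous_inclusion I X"
proof -
  let ?H = "\<lambda>t. least t / (\<Prod>j=1..n. \<phi> j (t j))"
  \<comment> \<open>The quantity assumed finite is itself the embedding constant.\<close>
  define C where "C = enn2real (Lp_star n p ?H)"
  have H: "?H \<in> borel_measurable (orthant_measure n)"
    using measurable_least measurable_weight by (rule borel_measurable_divide)
  have H0: "?H t \<ge> 0" if "t \<in> pos_orthant n" for t
    using that pos_orthantD by (intro divide_nonneg_pos less_imp_le[OF least_pos] weight_pos) auto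
  have C: "Lp_star n p ?H = ennreal C" "C \<ge> 0"
    using finite_Lp_least by (auto simp: C_def)
  interpret I: normed_subspace s I
    by (rule normed_subspace_intersection)
  have main: "a \<in> points X \<and> nnorm X a \<le> C * nnorm I a" if a: "a \<in> points I" for a
  proof -
    have S: "a \<in> S"
      using a by (rule K_le_intersection(1)[where t="\<lambda>_. 1"]) simp
    have nI: "nnorm I a \<ge> 0"
      by (rule I.nnorm_nonneg[OF a])
    have "Lp_star n p (quot a) \<le> Lp_star n p (\<lambda>t. nnorm I a * ?H t)"
    proof (rule Lp_star_mono[OF measurable_quot[OF S] _ p quot_nonneg[OF S]])
      show "(\<lambda>t. nnorm I a * ?H t) \<in> borel_measurable (orthant_measure n)"
        using H by (intro borel_measurable_times) auto
      fix t assume t: "t \<in> pos_orthant n"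
      have "quot a t \<le> least t * nnorm I a / (\<Prod>j=1..n. \<phi> j (t j))"
        unfolding quot_def using a pos_orthantD[OF t] weight_pos[of t]
        by (intro divide_right_mono K_le_intersection less_imp_le[OF weight_pos]) auto
      then show "quot a t \<le> nnorm I a * ?H t"
        by (simp add: mult.commute)
    qed
    also have "\<dots> \<le> ennreal (nnorm I a * C)"
      using H p nI H0 C by (intro Lp_star_cmult_le) auto
    finally have "Lp_star n p (quot a) \<le> ennreal (nnorm I a * C)" .
    from X_I[OF S this] show ?thesis
      using nI C by (simp add: mult.commute)
  qed
  then show ?thesis
    by (intro continuous_inclusionI[OF normed_subspace_intersection normed_subspace_X, of C]) auto
qed

lemma included_in_sum_space: "continuous_inclusion X (sum_space n A)"
  by (rule continuous_inclusionI[OF normed_subspace_X normed_subspace_sum_space _ nnorm_sum_space_le])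
     (auto simp: X_iff)

end

section \<open>Interpolation of morphisms\<close>

lemma (in normed_subspace) nnorm_le_opnorm:
  assumes Y: "normed_subspace sY Y" and T: "Vector_Spaces.linear s sY T" "bounded_between X Y T"
    and x: "x \<in> points X"
  shows "nnorm Y (T x) \<le> opnorm X Y T * nnorm X x"
proof (cases "x = 0")
  case True
  interpret Y: normed_subspace sY Y by fact
  interpret T: Vector_Spaces.linear s sY T by fact
  show ?thesis
    using True by (simp add: T.zero Y.nnorm_0 nnorm_0)
next
  case False
  interpret Y: normed_subspace sY Y by fact
  interpret T: Vector_Spaces.linear s sY T by fact
  obtain C where C: "\<And>x. x \<in> points X \<Longrightarrow> nnorm Y (T x) \<le> C * nnorm X x"
    and TY: "T ` points X \<subseteq> points Y"
    using T(2) by (auto simp: bounded_between_def)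
  have pos: "nnorm X x > 0"
    using False x nnorm_nonneg nnorm_eq_0_iff by (metis order_le_less)
  \<comment> \<open>Normalises \<open>x\<close>; the real factor is carried into the generic scalar
    field by \<open>of_real\<close>.\<close>
  define c :: 'k where "c = of_real (1 / nnorm X x)"
  have c: "norm c = 1 / nnorm X x"
    using pos by (simp add: c_def norm_divide)
  have cx: "s c x \<in> points X" "nnorm X (s c x) = 1"
    using x pos mem_scale by (simp_all add: nnorm_scale c)
  have "nnorm Y (T (s c x)) \<le> opnorm X Y T"
    unfolding opnorm_def
  proof (rule cSUP_upper)
    show "s c x \<in> {x \<in> points X. nnorm X x \<le> 1}"
      using cx by simp
    show "bdd_above ((\<lambda>x. nnorm Y (T x)) ` {x \<in> points X. nnorm X x \<le> 1})"
    proof (rule bdd_aboveI2)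
      fix y assume y: "y \<in> {x \<in> points X. nnorm X x \<le> 1}"
      then have "nnorm Y (T y) \<le> C * nnorm X y"
        using C by auto
      also have "\<dots> \<le> \<bar>C\<bar> * 1"
        using y nnorm_nonneg by (intro mult_mono) auto
      finally show "nnorm Y (T y) \<le> \<bar>C\<bar>"
        by simp
    qed
  qed
  then have "nnorm Y (T x) / nnorm X x \<le> opnorm X Y T"
    using x TY by (simp add: T.scale Y.nnorm_scale image_subset_iff c)
  then show ?thesis
    using pos by (simp add: pos_divide_le_eq)
qed

text \<open>Applying \<open>T\<close> to the components turns a decomposition of \<open>a\<close>
  into one of \<open>T a\<close>. Each bound \<open>M j\<close> is absorbed into its own weight, so
  no common factor is lost.\<close>

lemma K_functional_morphism_le:
  assumes A: "compatible_tuple n sA A" and B: "compatible_tuple n sB B" and T: "Vector_Spaces.linear sA sB T"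
    and M: "\<And>j. j \<le> n \<Longrightarrow> M j \<ge> 0"
    and bound: "\<And>j x. j \<le> n \<Longrightarrow> x \<in> points (A j) \<Longrightarrow>
      T x \<in> points (B j) \<and> nnorm (B j) (T x) \<le> M j * nnorm (A j) x"
    and w: "\<And>j. j \<le> n \<Longrightarrow> w j \<ge> 0" and a: "a \<in> points (sum_space n A)"
  shows "T a \<in> points (sum_space n B)" "K_functional n B w (T a) \<le> K_functional n A (\<lambda>j. M j * w j) a"
proof -
  interpret A: compatible_tuple n sA A by fact
  interpret B: compatible_tuple n sB B by fact
  interpret T: Vector_Spaces.linear sA sB T by fact
  have dec: "(\<lambda>j. T (x j)) \<in> decompositions n B (T a)" if "x \<in> decompositions n A a" for x
    using that bound by (auto simp: decompositions_def T.sum)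
  show "T a \<in> points (sum_space n B)"
    using a dec by (auto simp: A.S_iff B.S_iff)
  show "K_functional n B w (T a) \<le> K_functional n A (\<lambda>j. M j * w j) a"
  proof (rule A.K_greatest[OF _ a])
    fix x assume x: "x \<in> decompositions n A a"
    have "K_functional n B w (T a) \<le> (\<Sum>j\<le>n. w j * nnorm (B j) (T (x j)))"
      using w dec[OF x] by (rule B.K_le)
    also have "\<dots> \<le> (\<Sum>j\<le>n. w j * (M j * nnorm (A j) (x j)))"
      using w bound A.decomposition_mem[OF x] by (intro sum_mono mult_left_mono) auto
    finally show "K_functional n B w (T a) \<le> (\<Sum>j\<le>n. M j * w j * nnorm (A j) (x j))"
      by (simp add: ac_simps)
  qed (use M w in simp)
qed

text \<open>The \<open>M j\<close> are arbitrary positive bounds: the operator norms themselves give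
  the exact estimate when they are positive, and enlarged bounds give boundedness when some of them
  vanish.\<close>

lemma K_space_morphism_le:
  assumes A: "K_method n p \<phi> sA A" and B: "K_method n p \<phi> sB B" and T: "Vector_Spaces.linear sA sB T"
    and M: "\<And>j. j \<le> n \<Longrightarrow> M j > 0"
    and bound: "\<And>j x. j \<le> n \<Longrightarrow> x \<in> points (A j) \<Longrightarrow>
      T x \<in> points (B j) \<and> nnorm (B j) (T x) \<le> M j * nnorm (A j) x"
    and a: "a \<in> points (K_space n p \<phi> A)"
  shows "T a \<in> points (K_space n p \<phi> B)"
    "nnorm (K_space n p \<phi> B) (T a) \<le> type_function n \<phi> M * nnorm (K_space n p \<phi> A) a"
proof -
  interpret A: K_method n p \<phi> sA A by fact
  interpret B: K_method n p \<phi> sB B by fact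
  define c where "c j = M j / M 0" for j
  have c: "c j > 0" if "j \<le> n" for j
    using M[OF that] M[of 0] by (simp add: c_def)
  let ?S = "\<lambda>t. \<lambda>j\<in>{1..n}. c j * t j"
  let ?f = "type_function n \<phi> M"
  have f: "?f = M 0 * (\<Prod>j=1..n. boyd_bar (\<phi> j) (c j))"
    by (simp add: type_function_def c_def)
  have bar_pos: "(\<Prod>j=1..n. boyd_bar (\<phi> j) (c j)) > 0"
    using c by (intro A.boyd_bar_weight_pos) auto
  have f0: "?f > 0"
    unfolding f using M[of 0] bar_pos by simp
  have aS: "a \<in> points (sum_space n A)"
    using a by (simp add: A.X_iff)
  have TS: "T a \<in> points (sum_space n B)"
    using M bound aS
    by (intro K_functional_morphism_le(1)[where w="\<lambda>_. 1" and M=M,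
          OF A.compatible_tuple_axioms B.compatible_tuple_axioms T]) (blast intro: less_imp_le zero_le_one)+
  have c': "\<And>j. j \<in> {1..n} \<Longrightarrow> c j > 0"
    using c by auto
  have "Lp_star n p (B.quot (T a)) \<le> Lp_star n p (\<lambda>t. ?f * A.quot a (?S t))"
  proof (rule Lp_star_mono[OF B.measurable_quot[OF TS] _ A.p B.quot_nonneg[OF TS]])
    show "(\<lambda>t. ?f * A.quot a (?S t)) \<in> borel_measurable (orthant_measure n)"
      using A.measurable_quot_scale[OF aS c'] by (intro borel_measurable_times) auto
    fix t assume t: "t \<in> pos_orthant n"
    note tp = A.pos_orthantD[OF t]
    have Sp: "?S t j > 0" if "j \<in> {1..n}" for j
      using tp[OF that] c'[OF that] that by simp
    have "B.K t (T a) \<le> K_functional n A (\<lambda>j. M j * (t(0 := 1)) j) a"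
      using less_imp_le[OF M] bound A.upd_nonneg[OF tp] aS
      by (rule K_functional_morphism_le(2)[OF A.compatible_tuple_axioms B.compatible_tuple_axioms T])
    also have "\<dots> \<le> M 0 * A.K (?S t) a"
    proof (rule A.K_le_cmult[OF A.upd_nonneg[OF Sp] aS])
      fix j assume j: "j \<le> n"
      show "0 \<le> M j * (t(0 := 1)) j"
        using M[OF j] A.upd_nonneg[OF tp j] by (intro mult_nonneg_nonneg) auto
      show "M j * (t(0 := 1)) j \<le> M 0 * ((?S t)(0 := 1)) j"
        using j M[of 0] by (cases "j = 0") (auto simp: c_def)
    qed (use M[of 0] in auto)
    finally have K: "B.K t (T a) \<le> M 0 * A.K (?S t) a" .
    have w: "(\<Prod>j=1..n. \<phi> j (?S t j)) \<le> (\<Prod>j=1..n. boyd_bar (\<phi> j) (c j)) * (\<Prod>j=1..n. \<phi> j (t j))"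
      using A.weight_mult_le[of c t] c' tp by simp
    have KS: "A.K (?S t) a \<ge> 0"
      using Sp by (intro A.K_nonneg A.upd_nonneg aS)
    have wS: "(\<Prod>j=1..n. \<phi> j (?S t j)) > 0"
      using Sp by (rule A.weight_pos)
    have wt: "(\<Prod>j=1..n. \<phi> j (t j)) > 0"
      using tp by (rule A.weight_pos)
    have "B.quot (T a) t \<le> M 0 * A.K (?S t) a / (\<Prod>j=1..n. \<phi> j (t j))"
      unfolding B.quot_def using K wt by (intro divide_right_mono) auto
    also have "\<dots> = ?f * (A.K (?S t) a / ((\<Prod>j=1..n. boyd_bar (\<phi> j) (c j)) * (\<Prod>j=1..n. \<phi> j (t j))))"
    proof -
      have "m * P * (k / (P * v)) = m * k / v" if "P > 0" for m P k v :: real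
        using that by simp
      from this[OF bar_pos] show ?thesis
        unfolding f by (rule sym)
    qed
    \<comment> \<open>By \<open>w\<close> the denominator on the left dominates the weight at the
      rescaled point, so replacing it by that weight only enlarges the quotient.\<close>
    also have "\<dots> \<le> ?f * A.quot a (?S t)"
      unfolding A.quot_def using f0 w wS KS bar_pos wt
      by (intro mult_left_mono divide_left_mono mult_pos_pos) auto
    finally show "B.quot (T a) t \<le> ?f * A.quot a (?S t)" .
  qed
  also have "\<dots> \<le> ennreal (?f * nnorm A.X a)"
  proof (rule Lp_star_cmult_le[OF A.measurable_quot_scale[OF aS c'] A.p])
    show "0 \<le> A.quot a (?S t)" if "t \<in> pos_orthant n" for t
      using that scale_pos_orthant_iff[where c=c, OF c']
      by (intro A.quot_nonneg aS) (auto simp: pos_orthant_def PiE_def)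
    show "Lp_star n p (\<lambda>t. A.quot a (?S t)) \<le> ennreal (nnorm A.X a)"
      using Lp_star_scale[where c=c, OF A.measurable_quot[OF aS] A.p c' A.measurable_quot_scale[OF aS c']]
        A.Lp_quot[OF a] by (simp only: order_refl)
  qed (use f0 A.nnorm_X_nonneg in \<open>auto intro: less_imp_le\<close>)
  finally have "Lp_star n p (B.quot (T a)) \<le> ennreal (?f * nnorm A.X a)" .
  from B.X_I[OF TS this] show "T a \<in> points B.X" "nnorm B.X (T a) \<le> ?f * nnorm A.X a"
    using f0 A.nnorm_X_nonneg[of a] by simp_all
qed

lemma K_space_interpolation:
  assumes A: "K_method n p \<phi> sA A" and B: "K_method n p \<phi> sB B" and T: "tuple_morphism n sA A sB B T"
  shows "bounded_between (K_space n p \<phi> A) (K_space n p \<phi> B) T"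
    and "\<forall>j\<le>n. opnorm (A j) (B j) T > 0 \<Longrightarrow>
      opnorm (K_space n p \<phi> A) (K_space n p \<phi> B) T \<le> type_function n \<phi> (\<lambda>j. opnorm (A j) (B j) T)"
proof -
  interpret A: K_method n p \<phi> sA A by fact
  interpret B: K_method n p \<phi> sB B by fact
  have lin: "Vector_Spaces.linear sA sB T" and bdd: "\<And>j. j \<le> n \<Longrightarrow> bounded_between (A j) (B j) T"
    using T by (auto simp: tuple_morphism_def)
  have mem: "T x \<in> points (B j)" if "j \<le> n" "x \<in> points (A j)" for j x
    using bdd[OF that(1)] that(2) by (auto simp: bounded_between_def)
  have op: "nnorm (B j) (T x) \<le> opnorm (A j) (B j) T * nnorm (A j) x" if "j \<le> n" "x \<in> points (A j)" for j x
    using normed_subspace.nnorm_le_opnorm[OF A.normed_subspace[OF that(1)] B.normed_subspace[OF that(1)]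
        lin bdd[OF that(1)] that(2)] .
  \<comment> \<open>Operator norms may vanish while the estimate asks for positive bounds. Raising
    them to at least 1 loses the exact constant but is enough for boundedness.\<close>
  define M where "M j = max 1 (opnorm (A j) (B j) T)" for j
  have M: "M j > 0" for j
    by (simp add: M_def)
  have bM: "T x \<in> points (B j) \<and> nnorm (B j) (T x) \<le> M j * nnorm (A j) x" if "j \<le> n" "x \<in> points (A j)" for j x
  proof -
    have "opnorm (A j) (B j) T * nnorm (A j) x \<le> M j * nnorm (A j) x"
      using A.nnorm_nonneg[OF that] by (intro mult_right_mono) (auto simp: M_def)
    then show ?thesis
      using op[OF that] mem[OF that] by simp
  qed
  show "bounded_between A.X B.X T"
    unfolding bounded_between_def using K_space_morphism_le[OF A B lin M bM] by blast
  assume pos: "\<forall>j\<le>n. opnorm (A j) (B j) T > 0"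
  let ?f = "type_function n \<phi> (\<lambda>j. opnorm (A j) (B j) T)"
  have f0: "?f \<ge> 0"
    unfolding type_function_def
    using pos by (intro mult_nonneg_nonneg less_imp_le[OF A.boyd_bar_weight_pos]) (auto intro: less_imp_le)
  interpret AX: normed_subspace sA A.X
    by (rule A.normed_subspace_X)
  show "opnorm A.X B.X T \<le> ?f"
    unfolding opnorm_def[of A.X]
  proof (rule cSUP_least)
    show "{x \<in> points A.X. nnorm A.X x \<le> 1} \<noteq> {}"
      using AX.mem_zero AX.nnorm_0 by force
    fix a assume a: "a \<in> {x \<in> points A.X. nnorm A.X x \<le> 1}"
    then have "nnorm B.X (T a) \<le> ?f * nnorm A.X a"
      using pos mem op by (intro K_space_morphism_le(2)[OF A B lin]) auto
    also have "\<dots> \<le> ?f * 1"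
      using a f0 by (intro mult_left_mono) auto
    finally show "nnorm B.X (T a) \<le> ?f"
      by simp
  qed
qed

theorem proposition3p13:
  fixes n :: nat and p :: ennreal and \<phi> :: "nat \<Rightarrow> real \<Rightarrow> real"
    and sA :: "'k::real_normed_field \<Rightarrow> 'a::{topological_ab_group_add, t2_space} \<Rightarrow> 'a"
    and sB :: "'k \<Rightarrow> 'b::{topological_ab_group_add, t2_space} \<Rightarrow> 'b"
  assumes "n \<ge> 1" and "p \<ge> 1"
    and "\<And>j. j \<in> {1..n} \<Longrightarrow> boyd_function (\<phi> j)"
    and "Lp_star n p (\<lambda>t. Min (insert 1 (t ` {1..n})) / (\<Prod>j=1..n. \<phi> j (t j))) < \<infinity>"
  shows
    "(\<forall>A. banach_tuple n sA A \<longrightarrow>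
        banach_space_on sA (K_space n p \<phi> A) \<and>
        continuous_inclusion (intersection_space n A) (K_space n p \<phi> A) \<and>
        continuous_inclusion (K_space n p \<phi> A) (sum_space n A)) \<and>
     (\<forall>A B T. banach_tuple n sA A \<and> banach_tuple n sB B \<and> tuple_morphism n sA A sB B T \<longrightarrow>
        bounded_between (K_space n p \<phi> A) (K_space n p \<phi> B) T \<and>
        ((\<forall>j\<le>n. opnorm (A j) (B j) T > 0) \<longrightarrow>
          opnorm (K_space n p \<phi> A) (K_space n p \<phi> B) T
            \<le> type_function n \<phi> (\<lambda>j. opnorm (A j) (B j) T))) \<and>
     (\<forall>A. banach_tuple n sA A \<longrightarrow>
        (\<exists>C>0. \<forall>a\<in>points (K_space n p \<phi> A). \<forall>t. (\<forall>j\<in>{1..n}. t j > 0) \<longrightarrow>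
          K_functional n A (t(0 := 1)) a
            \<le> C * (\<Prod>j=1..n. \<phi> j (t j)) * nnorm (K_space n p \<phi> A) a))"
proof -
  \<comment> \<open>Generic in the ambient type, so that it applies to tuples over \<open>sA\<close>
    and over \<open>sB\<close> alike.\<close>
  have K: "K_method n p \<phi> s A"
    if "banach_tuple n s A"
    for s :: "'k \<Rightarrow> 'c::{topological_ab_group_add, t2_space} \<Rightarrow> 'c" and A
    using assms(2-4) that by unfold_locales
  have "\<exists>C>0. \<forall>a\<in>points (K_space n p \<phi> A). \<forall>t. (\<forall>j\<in>{1..n}. t j > 0) \<longrightarrow>
      K_functional n A (t(0 := 1)) a
        \<le> C * (\<Prod>j=1..n. \<phi> j (t j)) * nnorm (K_space n p \<phi> A) a"
    if "banach_tuple n sA A" for A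
  proof -
    interpret K_method n p \<phi> sA A
      using that by (rule K)
    show ?thesis
      using K_const(1) K_le_nnorm_X by (intro exI[of _ "1 / K_const"]) auto
  qed
  moreover have "banach_space_on sA (K_space n p \<phi> A) \<and>
      continuous_inclusion (intersection_space n A) (K_space n p \<phi> A) \<and>
      continuous_inclusion (K_space n p \<phi> A) (sum_space n A)" if "banach_tuple n sA A" for A
    using K_method.banach_X[OF K[OF that]] K_method.intersection_included[OF K[OF that]]
      K_method.included_in_sum_space[OF K[OF that]] by blast
  moreover have "bounded_between (K_space n p \<phi> A) (K_space n p \<phi> B) T"
    "(\<forall>j\<le>n. opnorm (A j) (B j) T > 0) \<longrightarrow>
      opnorm (K_space n p \<phi> A) (K_space n p \<phi> B) T
        \<le> type_function n \<phi> (\<lambda>j. opnorm (A j) (B j) T)"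
    if "banach_tuple n sA A" "banach_tuple n sB B" "tuple_morphism n sA A sB B T" for A B T
    using K_space_interpolation[OF K[OF that(1)] K[OF that(2)] that(3)] by blast+
  ultimately show ?thesis
    by blast
qed

end
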